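(* Let $X$ be a sequentially complete generalised Schwartz space and $(T(t))_{t\geq 0}$ a strongly continuous locally equicontinuous semigroup on $X$ with generator $(A,D(A))$. Then \[ \sigma_{\mathrm{bap}}(T(t))\setminus\{0\}=\mathrm{e}^{t\sigma_{\mathrm{bap}}(A)}\quad\text{and}\quad \sigma_{\mathrm{bap}}^{\mathrm{seq}}(T(t))\setminus\{0\}=\mathrm{e}^{t\sigma_{\mathrm{bap}}^{\mathrm{seq}}(A)} \] hold for all $t\geq 0$.
   Context: All locally convex spaces have scalar field $\mathbb{C}$. A generalised Schwartz space is a Hausdorff locally convex space in which every bounded subset is precompact. $\Gamma_X$ denotes a fundamental system of seminorms inducing the topology of $X$ (every continuous seminorm is bounded by a constant multiple of a member of $\Gamma_X$), and $\mathcal{L}(X)$ the space of continuous linear operators $X\to X$. A semigroup on $X$ is a family $(T(t))_{t\geq 0}$ in $\mathcal{L}(X)$ with $T(0)=\mathrm{id}$ and $T(t+s)=T(t)T(s)$ for all $t,s\geq 0$. It is strongly continuous if $t\mapsto T(t)x$ is continuous $[0,\infty)\to X$ for every $x\in X$. It is locally equicontinuous if for all $q\in\Gamma_X$ and $t_0\geq 0$ there are $p\in\Gamma_X$, $C\geq 0$ with $q(T(t)x)\leq Cp(x)$ for all $t\in[0,t_0]$, $x\in X$. The generator $(A,D(A))$ is given by $Ax=\lim_{t\to 0+}\frac{T(t)x-x}{t}$ with $D(A)$ the set of all $x\in X$ for which this limit exists in $X$. For a linear operator $(B,D(B))$ on $X$, $\sigma_{\mathrm{bap}}(B)$ is the set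 of all $\lambda\in\mathbb{C}$ for which there is a bounded net $(x_i)_{i\in I}\subseteq D(B)$ (i.e. $\{x_i\mid i\in I\}$ is bounded in $X$) not converging to $0$ with $\lim_{i\in I}(B-\lambda)x_i=0$; $\sigma_{\mathrm{bap}}^{\mathrm{seq}}(B)$ is defined likewise with bounded sequences instead of bounded nets. For $M\subseteq\mathbb{C}$, $\mathrm{e}^{tM}:=\{\mathrm{e}^{t\lambda}\mid\lambda\in M\}$.
   Formalization: At t = 0 each identity is claimed only if the corresponding spectrum of A is nonempty; as stated it fails at t = 0 when that spectrum is empty and X ≠ {0} (e.g. the right shift on smooth functions on [0,1] flat at 0), since the left side is {1} and the right side is empty. *)

theory Defs
  imports "HOL-Analysis.Analysis"
begin

section \<open>Locally convex spaces\<close>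

definition seminorm :: "(complex \<Rightarrow> 'a::ab_group_add \<Rightarrow> 'a) \<Rightarrow> ('a \<Rightarrow> real) \<Rightarrow> bool" where
  "seminorm scl p \<longleftrightarrow>
     (\<forall>x. 0 \<le> p x) \<and> (\<forall>x y. p (x + y) \<le> p x + p y) \<and> (\<forall>c x. p (scl c x) = cmod c * p x)"

text \<open>
  A Hausdorff locally convex space over the complex numbers, given together with a fundamental
  system \<open>\<Gamma>\<close> of seminorms inducing its topology. The uniformity is the canonical (translation
  invariant) one, so that \<^const>\<open>Cauchy\<close> and \<^const>\<open>totally_bounded\<close> (precompact) have their usual
  meaning in locally convex spaces. The class \<open>topological_ab_group_add\<close> is implied by the other
  assumptions; it is listed only to make its library lemmas available.
\<close>
locale locally_convex_space = vector_space scl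
  for scl :: "complex \<Rightarrow> 'a::{topological_ab_group_add, uniform_space, t2_space} \<Rightarrow> 'a" +
  fixes \<Gamma> :: "('a \<Rightarrow> real) set"
  assumes seminorm_mem: "p \<in> \<Gamma> \<Longrightarrow> seminorm scl p"
    and uniformity_seminorms:
      "uniformity = (INF p\<in>\<Gamma>. INF e\<in>{0<..}. principal {(x, y). p (x - y) < e})"
    and fundamental:
      "seminorm scl q \<Longrightarrow> continuous_on UNIV q \<Longrightarrow> \<exists>p\<in>\<Gamma>. \<exists>C. \<forall>x. q x \<le> C * p x"

definition lcs_bounded :: "('a \<Rightarrow> real) set \<Rightarrow> 'a set \<Rightarrow> bool" where
  "lcs_bounded \<Gamma> S \<longleftrightarrow> (\<forall>p\<in>\<Gamma>. \<exists>C. \<forall>x\<in>S. p x \<le> C)"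

definition generalised_Schwartz_space ::
  "(complex \<Rightarrow> 'a::{topological_ab_group_add, uniform_space, t2_space} \<Rightarrow> 'a)
     \<Rightarrow> ('a \<Rightarrow> real) set \<Rightarrow> bool" where
  "generalised_Schwartz_space scl \<Gamma> \<longleftrightarrow>
     locally_convex_space scl \<Gamma> \<and> (\<forall>S. lcs_bounded \<Gamma> S \<longrightarrow> totally_bounded S)"

section \<open>Semigroups and generators\<close>

text \<open>The time parameter is a real number; the values \<open>T t\<close> for \<open>t < 0\<close> are irrelevant.\<close>

definition operator_semigroup ::
  "(complex \<Rightarrow> 'a::{ab_group_add, topological_space} \<Rightarrow> 'a) \<Rightarrow> (real \<Rightarrow> 'a \<Rightarrow> 'a) \<Rightarrow> bool" where
  "operator_semigroup scl T \<longleftrightarrow>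
     (\<forall>t\<ge>0. Vector_Spaces.linear scl scl (T t) \<and> continuous_on UNIV (T t)) \<and>
     T 0 = id \<and> (\<forall>t\<ge>0. \<forall>s\<ge>0. T (t + s) = T t \<circ> T s)"

definition strongly_continuous :: "(real \<Rightarrow> 'a \<Rightarrow> 'a::topological_space) \<Rightarrow> bool" where
  "strongly_continuous T \<longleftrightarrow> (\<forall>x. continuous_on {0..} (\<lambda>t. T t x))"

definition locally_equicontinuous :: "('a \<Rightarrow> real) set \<Rightarrow> (real \<Rightarrow> 'a \<Rightarrow> 'a) \<Rightarrow> bool" where
  "locally_equicontinuous \<Gamma> T \<longleftrightarrow>
     (\<forall>q\<in>\<Gamma>. \<forall>t\<^sub>0\<ge>0. \<exists>p\<in>\<Gamma>. \<exists>C\<ge>0. \<forall>t\<in>{0..t\<^sub>0}. \<forall>x. q (T t x) \<le> C * p x)"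

definition difference_quotient ::
  "(complex \<Rightarrow> 'a::ab_group_add \<Rightarrow> 'a) \<Rightarrow> (real \<Rightarrow> 'a \<Rightarrow> 'a) \<Rightarrow> 'a \<Rightarrow> real \<Rightarrow> 'a" where
  "difference_quotient scl T x t = scl (complex_of_real (1 / t)) (T t x - x)"

definition generator_domain ::
  "(complex \<Rightarrow> 'a::{ab_group_add, topological_space} \<Rightarrow> 'a) \<Rightarrow> (real \<Rightarrow> 'a \<Rightarrow> 'a) \<Rightarrow> 'a set" where
  "generator_domain scl T = {x. \<exists>y. (difference_quotient scl T x \<longlongrightarrow> y) (at_right 0)}"

text \<open>Only meaningful on \<^const>\<open>generator_domain\<close>; elsewhere the value is unspecified.\<close>

definition generator ::
  "(complex \<Rightarrow> 'a::{ab_group_add, t2_space} \<Rightarrow> 'a) \<Rightarrow> (real \<Rightarrow> 'a \<Rightarrow> 'a) \<Rightarrow> 'a \<Rightarrow> 'a" where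
  "generator scl T x = Lim (at_right 0) (difference_quotient scl T x)"

section \<open>Nets\<close>

definition directed_set :: "'i set \<Rightarrow> ('i \<Rightarrow> 'i \<Rightarrow> bool) \<Rightarrow> bool" where
  "directed_set I le \<longleftrightarrow> I \<noteq> {} \<and> (\<forall>i\<in>I. le i i) \<and>
     (\<forall>i\<in>I. \<forall>j\<in>I. \<forall>k\<in>I. le i j \<longrightarrow> le j k \<longrightarrow> le i k) \<and>
     (\<forall>i\<in>I. \<forall>j\<in>I. \<exists>k\<in>I. le i k \<and> le j k)"

text \<open>
  Convergence of a net \<open>x\<close> over the directed set \<open>(I, le)\<close> is convergence along its filter of tails.
\<close>
definition tails :: "'i set \<Rightarrow> ('i \<Rightarrow> 'i \<Rightarrow> bool) \<Rightarrow> 'i filter" where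
  "tails I le = (INF i\<in>I. principal {j\<in>I. le i j})"

lemma eventually_tails:
  assumes "directed_set I le"
  shows "eventually P (tails I le) \<longleftrightarrow> (\<exists>i\<in>I. \<forall>j\<in>I. le i j \<longrightarrow> P j)"
proof -
  have "eventually P (tails I le) \<longleftrightarrow> (\<exists>i\<in>I. eventually P (principal {j\<in>I. le i j}))"
    unfolding tails_def
  proof (rule eventually_INF_base)
    show "I \<noteq> {}"
      using assms by (simp add: directed_set_def)
    fix i j assume "i \<in> I" "j \<in> I"
    then obtain k where k: "k \<in> I" "le i k" "le j k"
      using assms unfolding directed_set_def by blast
    then have "{l\<in>I. le k l} \<subseteq> {l\<in>I. le i l} \<inter> {l\<in>I. le j l}"
      using assms \<open>i \<in> I\<close> \<open>j \<in> I\<close> unfolding directed_set_def by blast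
    then show "\<exists>k\<in>I. principal {l\<in>I. le k l}
        \<le> inf (principal {l\<in>I. le i l}) (principal {l\<in>I. le j l})"
      using k(1) by auto
  qed
  then show ?thesis
    by (auto simp: eventually_principal)
qed

section \<open>The bounded approximate point spectra\<close>

text \<open>
  A definition cannot quantify over all index types, so the nets are indexed by sets of points
  of \<open>X\<close>. Lemma \<open>sigma_bapI\<close> below shows that nets over any other index type yield no further
  spectral values. \<open>D\<close> is the domain of the operator \<open>B\<close>.
\<close>
definition sigma_bap ::
  "(complex \<Rightarrow> 'a::{ab_group_add, topological_space} \<Rightarrow> 'a) \<Rightarrow> ('a \<Rightarrow> real) set
     \<Rightarrow> 'a set \<Rightarrow> ('a \<Rightarrow> 'a) \<Rightarrow> complex set" where
  "sigma_bap scl \<Gamma> D B =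
     {\<mu>. \<exists>(I :: 'a set set) le (x :: 'a set \<Rightarrow> 'a).
        directed_set I le \<and> x ` I \<subseteq> D \<and> lcs_bounded \<Gamma> (x ` I) \<and>
        \<not> (x \<longlongrightarrow> 0) (tails I le) \<and> ((\<lambda>i. B (x i) - scl \<mu> (x i)) \<longlongrightarrow> 0) (tails I le)}"

definition sigma_bap_seq ::
  "(complex \<Rightarrow> 'a::{ab_group_add, topological_space} \<Rightarrow> 'a) \<Rightarrow> ('a \<Rightarrow> real) set
     \<Rightarrow> 'a set \<Rightarrow> ('a \<Rightarrow> 'a) \<Rightarrow> complex set" where
  "sigma_bap_seq scl \<Gamma> D B =
     {\<mu>. \<exists>x :: nat \<Rightarrow> 'a. range x \<subseteq> D \<and> lcs_bounded \<Gamma> (range x) \<and>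
        \<not> x \<longlonglongrightarrow> 0 \<and> (\<lambda>n. B (x n) - scl \<mu> (x n)) \<longlonglongrightarrow> 0}"

lemma sigma_bapI:
  fixes scl :: "complex \<Rightarrow> 'a::{ab_group_add, topological_space} \<Rightarrow> 'a"
    and I :: "'i set" and x :: "'i \<Rightarrow> 'a"
  assumes I: "directed_set I le" and D: "x ` I \<subseteq> D" and bdd: "lcs_bounded \<Gamma> (x ` I)"
    and nz: "\<not> (x \<longlongrightarrow> 0) (tails I le)"
    and lim: "((\<lambda>i. B (x i) - scl \<mu> (x i)) \<longlongrightarrow> 0) (tails I le)"
  shows "\<mu> \<in> sigma_bap scl \<Gamma> D B"
proof -
  obtain U where U: "open U" "0 \<in> U" and notin: "\<And>i. i \<in> I \<Longrightarrow> \<exists>j\<in>I. le i j \<and> x j \<notin> U"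
    using nz unfolding tendsto_def eventually_tails[OF I] by blast
  define N where "N = {V :: 'a set. open V \<and> 0 \<in> V}"
  define ge where "ge = (\<lambda>V W :: 'a set. W \<subseteq> V)"
  have N: "directed_set N ge"
    unfolding directed_set_def N_def ge_def
  proof (intro conjI ballI impI)
    show "{V :: 'a set. open V \<and> 0 \<in> V} \<noteq> {}"
      using U by blast
    fix V W :: "'a set" assume "V \<in> {V. open V \<and> 0 \<in> V}" "W \<in> {V. open V \<and> 0 \<in> V}"
    then show "\<exists>k\<in>{V. open V \<and> 0 \<in> V}. k \<subseteq> V \<and> k \<subseteq> W"
      by (intro bexI[of _ "V \<inter> W"]) auto
  qed auto
  have "\<exists>j\<in>I. x j \<notin> U \<and> B (x j) - scl \<mu> (x j) \<in> V" if V: "V \<in> N" for V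
  proof -
    have "eventually (\<lambda>i. B (x i) - scl \<mu> (x i) \<in> V) (tails I le)"
      using lim V unfolding N_def by (auto intro: topological_tendstoD)
    then obtain i where "i \<in> I" "\<And>j. j \<in> I \<Longrightarrow> le i j \<Longrightarrow> B (x j) - scl \<mu> (x j) \<in> V"
      unfolding eventually_tails[OF I] by blast
    then show ?thesis
      using notin by blast
  qed
  then obtain j where j: "\<And>V. V \<in> N \<Longrightarrow> j V \<in> I" "\<And>V. V \<in> N \<Longrightarrow> x (j V) \<notin> U"
      "\<And>V. V \<in> N \<Longrightarrow> B (x (j V)) - scl \<mu> (x (j V)) \<in> V"
    by metis
  have sub: "(\<lambda>V. x (j V)) ` N \<subseteq> x ` I"
    using j(1) by auto
  have "directed_set N ge \<and> (\<lambda>V. x (j V)) ` N \<subseteq> D \<and> lcs_bounded \<Gamma> ((\<lambda>V. x (j V)) ` N) \<and>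
      \<not> ((\<lambda>V. x (j V)) \<longlongrightarrow> 0) (tails N ge) \<and>
      ((\<lambda>V. B (x (j V)) - scl \<mu> (x (j V))) \<longlongrightarrow> 0) (tails N ge)"
  proof (intro conjI)
    show "(\<lambda>V. x (j V)) ` N \<subseteq> D"
      using sub D by blast
    show "lcs_bounded \<Gamma> ((\<lambda>V. x (j V)) ` N)"
      using bdd sub unfolding lcs_bounded_def by (meson subsetD)
    show "\<not> ((\<lambda>V. x (j V)) \<longlongrightarrow> 0) (tails N ge)"
    proof
      assume "((\<lambda>V. x (j V)) \<longlongrightarrow> 0) (tails N ge)"
      then have "eventually (\<lambda>V. x (j V) \<in> U) (tails N ge)"
        using U by (rule topological_tendstoD)
      then obtain V where "V \<in> N" "x (j V) \<in> U"
        unfolding eventually_tails[OF N] by (auto simp: ge_def)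
      then show False
        using j(2) by blast
    qed
    show "((\<lambda>V. B (x (j V)) - scl \<mu> (x (j V))) \<longlongrightarrow> 0) (tails N ge)"
    proof (rule topological_tendstoI)
      fix S :: "'a set" assume "open S" "0 \<in> S"
      then have "S \<in> N"
        by (simp add: N_def)
      then show "eventually (\<lambda>V. B (x (j V)) - scl \<mu> (x (j V)) \<in> S) (tails N ge)"
        unfolding eventually_tails[OF N] using j(3) by (fastforce simp: ge_def)
    qed
  qed (fact N)
  then show ?thesis
    unfolding sigma_bap_def mem_Collect_eq by (intro exI)
qed

end

theory Submission
  imports Defs
begin

text \<open>
  Write \<open>A\<close> for the generator and let \<open>t > 0\<close>. If \<open>x i\<close> are approximate eigenvectors of \<open>A\<close> for \<open>\<mu>\<close>, then the
  difference \<open>exp (- t * \<mu>) T t (x i) - x i\<close> is the integral over \<open>{0..t}\<close> of \<open>exp (- s * \<mu>) T s\<close> applied to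
  \<open>A (x i) - \<mu> (x i)\<close>, and equicontinuity makes it small. So \<open>x i\<close> are approximate eigenvectors of \<open>T t\<close>.

  Conversely, let \<open>x i\<close> be approximate eigenvectors of \<open>T t\<close> for \<open>\<nu> \<noteq> 0\<close>. For each of the solutions \<open>\<mu>\<close> of
  \<open>exp (t * \<mu>) = \<nu>\<close> let \<open>y i\<close> be the integral of \<open>exp (- s * \<mu>) T s (x i)\<close> over \<open>{0..t}\<close>. It lies in the
  domain of \<open>A\<close>, and \<open>A (y i) - \<mu> (y i) = exp (- t * \<mu>) T t (x i) - x i\<close> tends to \<open>0\<close>. The families \<open>y\<close> are
  bounded, so it remains to find a \<open>\<mu>\<close> for which \<open>y\<close> does not tend to \<open>0\<close>. As \<open>\<mu>\<close> varies, \<open>y i\<close> runs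
  through the Fourier coefficients of one function, the rescaled orbit of \<open>x i\<close>. If all of them tended to \<open>0\<close>,
  so would, by the theorem of Stone and Weierstrass, the integral of this orbit against every continuous
  function on the circle, in particular against a bump concentrated near time \<open>0\<close>. This is where the generalised
  Schwartz property is used: the bounded set of all \<open>x i\<close> is precompact, so its orbits are uniformly
  continuous at \<open>0\<close>, and the integral against the bump is close to a fixed positive multiple of \<open>x i\<close>. Then
  \<open>x\<close> would tend to \<open>0\<close>, a contradiction (\<open>tendsto_0_if_fourier_coefficients_tendsto_0\<close>).

  Both constructions keep the index set, so one argument covers nets and sequences. The vector-valued
  integrals are values of antiderivatives, which exist by sequential completeness
  (\<open>antiderivative_exists\<close>) and are controlled in each seminorm by a mean value inequality for right
  derivatives (\<open>mean_value_inequality\<close>). For \<open>t = 0\<close> the operator is the identity, whose only possible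
  spectral value is \<open>1\<close>.
\<close>

section \<open>Calculus with seminorms\<close>

context locally_convex_space
begin

lemma seminorm_nonneg: "p \<in> \<Gamma> \<Longrightarrow> 0 \<le> p x"
  and seminorm_triangle: "p \<in> \<Gamma> \<Longrightarrow> p (x + y) \<le> p x + p y"
  and seminorm_scale: "p \<in> \<Gamma> \<Longrightarrow> p (scl c x) = cmod c * p x"
  using seminorm_mem[of p] unfolding seminorm_def by auto

lemma seminorm_zero: "p \<in> \<Gamma> \<Longrightarrow> p 0 = 0"
  using seminorm_scale[of p 0 0] by simp

lemma seminorm_minus: "p \<in> \<Gamma> \<Longrightarrow> p (- x) = p x"
  using seminorm_scale[of p "-1" x] by simp

lemma seminorm_minus_commute: "p \<in> \<Gamma> \<Longrightarrow> p (x - y) = p (y - x)"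
  using seminorm_minus[of p "x - y"] by simp

lemma seminorm_diff_le: "p \<in> \<Gamma> \<Longrightarrow> p (x - z) \<le> p (x - y) + p (y - z)"
  using seminorm_triangle[of p "x - y" "y - z"] by simp

lemma nhds_seminorms:
  "nhds x = (INF p\<in>\<Gamma>. INF e\<in>{0<..}. principal {y. p (x - y) < e})"
  unfolding nhds_eq_comap_uniformity uniformity_seminorms filtercomap_INF filtercomap_principal
  by (simp add: vimage_def)

lemma tendsto_iff_seminorms:
  "(f \<longlongrightarrow> l) F \<longleftrightarrow> (\<forall>p\<in>\<Gamma>. ((\<lambda>i. p (f i - l)) \<longlongrightarrow> 0) F)"
proof -
  have "(f \<longlongrightarrow> l) F \<longleftrightarrow> (\<forall>p\<in>\<Gamma>. \<forall>e>0. eventually (\<lambda>i. p (l - f i) < e) F)"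
    unfolding nhds_seminorms filterlim_INF filterlim_principal by auto
  also have "\<dots> \<longleftrightarrow> (\<forall>p\<in>\<Gamma>. ((\<lambda>i. p (f i - l)) \<longlongrightarrow> 0) F)"
    unfolding tendsto_iff dist_real_def
    using seminorm_nonneg seminorm_minus_commute by simp
  finally show ?thesis .
qed

lemma tendsto_seminorm:
  assumes "p \<in> \<Gamma>" "(f \<longlongrightarrow> l) F"
  shows "((\<lambda>i. p (f i)) \<longlongrightarrow> p l) F"
proof -
  have "\<bar>p (f i) - p l\<bar> \<le> p (f i - l)" for i
    using seminorm_diff_le[OF assms(1), of "f i" 0 l] seminorm_diff_le[OF assms(1), of l 0 "f i"]
      seminorm_minus_commute[OF assms(1), of l "f i"] by simp
  moreover have "((\<lambda>i. p (f i - l)) \<longlongrightarrow> 0) F"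
    using assms tendsto_iff_seminorms by blast
  ultimately have "((\<lambda>i. p (f i) - p l) \<longlongrightarrow> 0) F"
    by (intro Lim_null_comparison[of "\<lambda>i. p (f i) - p l" "\<lambda>i. p (f i - l)"]) auto
  then show ?thesis
    by (simp add: LIM_zero_iff)
qed

lemma tendsto_scale:
  assumes "(c \<longlongrightarrow> c0) F" "(f \<longlongrightarrow> l) F"
  shows "((\<lambda>i. scl (c i) (f i)) \<longlongrightarrow> scl c0 l) F"
  unfolding tendsto_iff_seminorms
proof
  fix p assume p: "p \<in> \<Gamma>"
  have "p (scl (c i) (f i) - scl c0 l) \<le> cmod (c i - c0) * p (f i) + cmod c0 * p (f i - l)" for i
    using seminorm_diff_le[OF p, of "scl (c i) (f i)" "scl c0 l" "scl c0 (f i)"]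
    by (simp add: seminorm_scale[OF p] flip: scale_left_diff_distrib scale_right_diff_distrib)
  moreover have "((\<lambda>i. cmod (c i - c0) * p (f i) + cmod c0 * p (f i - l)) \<longlongrightarrow>
      cmod (c0 - c0) * p l + cmod c0 * 0) F"
    using assms p tendsto_iff_seminorms by (intro tendsto_intros tendsto_seminorm) auto
  ultimately show "((\<lambda>i. p (scl (c i) (f i) - scl c0 l)) \<longlongrightarrow> 0) F"
    using seminorm_nonneg[OF p]
    by (intro Lim_null_comparison[of "\<lambda>i. p (scl (c i) (f i) - scl c0 l)"]) auto
qed

lemma continuous_on_seminorm:
  "p \<in> \<Gamma> \<Longrightarrow> continuous_on S f \<Longrightarrow> continuous_on S (\<lambda>x. p (f x))"
  unfolding continuous_on_def by (auto intro: tendsto_seminorm)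

lemma continuous_on_scale:
  "continuous_on S c \<Longrightarrow> continuous_on S f \<Longrightarrow> continuous_on S (\<lambda>x. scl (c x) (f x))"
  unfolding continuous_on_def by (auto intro: tendsto_scale)

lemma eq_if_seminorms_zero:
  assumes "\<And>p. p \<in> \<Gamma> \<Longrightarrow> p (x - y) = 0"
  shows "x = y"
proof -
  have "((\<lambda>n :: nat. x) \<longlongrightarrow> y) sequentially"
    unfolding tendsto_iff_seminorms
  proof
    fix p assume "p \<in> \<Gamma>"
    from assms[OF this] show "((\<lambda>n :: nat. p (x - y)) \<longlongrightarrow> 0) sequentially"
      by simp
  qed
  then show ?thesis
    by (simp add: tendsto_const_iff)
qed

lemma Cauchy_if_seminorms:
  assumes "\<And>p e. p \<in> \<Gamma> \<Longrightarrow> 0 < e \<Longrightarrow> \<exists>N. \<forall>m\<ge>N. \<forall>n\<ge>N. p (X m - X n) < e"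
  shows "Cauchy X"
proof -
  have "filterlim (\<lambda>(m, n). (X m, X n)) (principal {(x, y). p (x - y) < e})
      (sequentially \<times>\<^sub>F sequentially)" if "p \<in> \<Gamma>" "0 < e" for p e
    using assms[OF that] unfolding filterlim_principal eventually_prod_sequentially by auto
  then have "filterlim (\<lambda>(m, n). (X m, X n)) uniformity (sequentially \<times>\<^sub>F sequentially)"
    unfolding uniformity_seminorms filterlim_INF by auto
  then have lim: "eventually (\<lambda>(m, n). P (X m, X n)) (sequentially \<times>\<^sub>F sequentially)"
    if "eventually P uniformity" for P
    using that unfolding filterlim_iff by (auto simp: case_prod_unfold)
  show ?thesis
    unfolding Cauchy_uniform_iff
  proof (intro allI impI)
    fix P :: "'a \<times> 'a \<Rightarrow> bool" assume "eventually P uniformity"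
    from lim[OF this] show "\<exists>N. \<forall>n\<ge>N. \<forall>m\<ge>N. P (X n, X m)"
      unfolding eventually_prod_sequentially by auto
  qed
qed

lemma totally_bounded_seminormE:
  assumes "totally_bounded S" "p \<in> \<Gamma>" "0 < e"
  obtains Y where "finite Y" "\<And>x. x \<in> S \<Longrightarrow> \<exists>y\<in>Y. p (x - y) < e"
proof -
  have "eventually (\<lambda>(x, y). p (x - y) < e) uniformity"
  proof -
    have "uniformity \<le> principal {(x, y). p (x - y) < e}"
      unfolding uniformity_seminorms using assms(2,3) by (intro INF_lower2[of p] INF_lower2[of e]) auto
    then show ?thesis
      unfolding le_principal by (simp add: case_prod_unfold)
  qed
  then have "\<exists>Y. finite Y \<and> (\<forall>s\<in>S. \<exists>y\<in>Y. p (y - s) < e)"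
    using assms(1) unfolding totally_bounded_def by fastforce
  then show ?thesis
    using that seminorm_minus_commute[OF assms(2)] by metis
qed

end

section \<open>One-sided derivatives\<close>

text \<open>
  The set of points where \<open>\<psi>\<close> does not exceed \<open>\<psi> a\<close> is closed, so it contains its supremum, and the
  hypothesis at the supremum would produce a larger element if the supremum were not \<open>b\<close>.
\<close>
lemma le_if_locally_nonincreasing_right:
  fixes \<psi> :: "real \<Rightarrow> real"
  assumes "a \<le> b" "continuous_on {a..b} \<psi>"
    and dec: "\<And>r. a \<le> r \<Longrightarrow> r < b \<Longrightarrow> eventually (\<lambda>h. \<psi> (r + h) \<le> \<psi> r) (at_right 0)"
  shows "\<psi> b \<le> \<psi> a"
proof -
  define R where "R = {r \<in> {a..b}. \<psi> r \<le> \<psi> a}"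
  have "closed R"
    unfolding R_def using assms(2) by (intro continuous_on_closed_Collect_le) auto
  have R: "a \<in> R" "bdd_above R" "R \<subseteq> {a..b}"
    using assms(1) by (auto simp: R_def intro: bdd_above_mono[of "{a..b}"])
  then have m: "Sup R \<in> R"
    using \<open>closed R\<close> by (intro closed_contains_Sup) auto
  show ?thesis
  proof (cases "Sup R < b")
    case True
    have "eventually (\<lambda>h. \<psi> (Sup R + h) \<le> \<psi> (Sup R) \<and> h < b - Sup R \<and> 0 < h) (at_right 0)"
      using True m R(3)
      by (intro eventually_conj dec) (auto intro: eventually_at_rightI[of 0 "b - Sup R"] eventually_at_right_less)
    then obtain h where h: "\<psi> (Sup R + h) \<le> \<psi> (Sup R)" "h < b - Sup R" "0 < h"
      using eventually_happens[of _ "at_right (0::real)"] by auto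
    then have "Sup R + h \<in> R"
      using m unfolding R_def by auto
    then show ?thesis
      using h(3) cSup_upper[OF _ R(2)] by fastforce
  next
    case False
    then show ?thesis
      using m unfolding R_def by auto
  qed
qed

context locally_convex_space
begin

definition right_deriv :: "(real \<Rightarrow> 'a) \<Rightarrow> 'a \<Rightarrow> real \<Rightarrow> bool" where
  "right_deriv G v r \<longleftrightarrow>
     ((\<lambda>h. scl (complex_of_real (1 / h)) (G (r + h) - G r)) \<longlongrightarrow> v) (at_right 0)"

lemma right_deriv_add:
  "right_deriv G v r \<Longrightarrow> right_deriv H w r \<Longrightarrow> right_deriv (\<lambda>s. G s + H s) (v + w) r"
  unfolding right_deriv_def
  by (drule (1) tendsto_add) (simp add: algebra_simps)

lemma right_deriv_scale:
  "right_deriv G v r \<Longrightarrow> right_deriv (\<lambda>s. scl c (G s)) (scl c v) r"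
  unfolding right_deriv_def
  by (drule tendsto_scale[OF tendsto_const[of c]]) (simp add: algebra_simps)

lemma right_deriv_diff:
  "right_deriv G v r \<Longrightarrow> right_deriv H w r \<Longrightarrow> right_deriv (\<lambda>s. G s - H s) (v - w) r"
  using right_deriv_add[of G v r "\<lambda>s. scl (-1) (H s)" "scl (-1) w"] right_deriv_scale[of H w r "-1"]
  by simp

lemma right_deriv_scale_const:
  assumes "((\<lambda>h. (\<phi> (r + h) - \<phi> r) / h) \<longlongrightarrow> d) (at_right 0)"
  shows "right_deriv (\<lambda>s. scl (complex_of_real (\<phi> s)) v) (scl (complex_of_real d) v) r"
  unfolding right_deriv_def
proof -
  have "((\<lambda>h. scl (complex_of_real ((\<phi> (r + h) - \<phi> r) / h)) v) \<longlongrightarrow> scl (complex_of_real d) v) (at_right 0)"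
    using assms by (intro tendsto_scale tendsto_intros)
  then show "((\<lambda>h. scl (complex_of_real (1 / h))
      (scl (complex_of_real (\<phi> (r + h))) v - scl (complex_of_real (\<phi> r)) v))
      \<longlongrightarrow> scl (complex_of_real d) v) (at_right 0)"
    by (simp flip: scale_left_diff_distrib)
qed

text \<open>
  Seminorms have no derivatives of their own, but for every \<open>e > 0\<close> the real function
  \<open>p (G r - G a) - \<phi> r - e * r\<close> is locally nonincreasing to the right, by the triangle inequality.
\<close>
lemma mean_value_inequality:
  fixes \<phi> \<phi>' :: "real \<Rightarrow> real"
  assumes p: "p \<in> \<Gamma>" and "a \<le> b" "continuous_on {a..b} G" "continuous_on {a..b} \<phi>"
    and G: "\<And>r. a \<le> r \<Longrightarrow> r < b \<Longrightarrow> right_deriv G (g r) r"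
    and \<phi>: "\<And>r. a \<le> r \<Longrightarrow> r < b \<Longrightarrow> ((\<lambda>h. (\<phi> (r + h) - \<phi> r) / h) \<longlongrightarrow> \<phi>' r) (at_right 0)"
    and le: "\<And>r. a \<le> r \<Longrightarrow> r < b \<Longrightarrow> p (g r) \<le> \<phi>' r"
  shows "p (G b - G a) \<le> \<phi> b - \<phi> a"
proof -
  have eps: "p (G b - G a) \<le> \<phi> b - \<phi> a + e * (b - a)" if e: "0 < e" for e
  proof -
    define \<psi> where "\<psi> r = p (G r - G a) - \<phi> r - e * r" for r
    have "\<psi> b \<le> \<psi> a"
    proof (rule le_if_locally_nonincreasing_right[where \<psi> = \<psi>])
      show "continuous_on {a..b} \<psi>"
        unfolding \<psi>_def using assms by (intro continuous_intros continuous_on_seminorm)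
      fix r assume r: "a \<le> r" "r < b"
      have "((\<lambda>h. p (scl (complex_of_real (1 / h)) (G (r + h) - G r)) - (\<phi> (r + h) - \<phi> r) / h)
          \<longlongrightarrow> p (g r) - \<phi>' r) (at_right 0)"
        using G[OF r] \<phi>[OF r] unfolding right_deriv_def by (intro tendsto_diff tendsto_seminorm p)
      moreover have "p (g r) - \<phi>' r < e"
        using le[OF r] e by simp
      ultimately have "eventually (\<lambda>h. p (scl (complex_of_real (1 / h)) (G (r + h) - G r))
          - (\<phi> (r + h) - \<phi> r) / h < e) (at_right 0)"
        by (rule order_tendstoD(2))
      then show "eventually (\<lambda>h. \<psi> (r + h) \<le> \<psi> r) (at_right 0)"
        using eventually_at_right_less[of 0]
      proof eventually_elim
        case (elim h)
        then have "(p (G (r + h) - G r) - (\<phi> (r + h) - \<phi> r)) / h < e"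
          by (simp add: seminorm_scale[OF p] diff_divide_distrib norm_divide)
        then have "p (G (r + h) - G r) - (\<phi> (r + h) - \<phi> r) < e * h"
          using elim(2) by (simp add: divide_less_eq)
        then show ?case
          using seminorm_diff_le[OF p, of "G (r + h)" "G a" "G r"]
          by (simp add: \<psi>_def algebra_simps)
      qed
    qed fact
    then show ?thesis
      by (simp add: \<psi>_def algebra_simps seminorm_zero[OF p])
  qed
  have "((\<lambda>e. \<phi> b - \<phi> a + e * (b - a)) \<longlongrightarrow> \<phi> b - \<phi> a + 0 * (b - a)) (at_right 0)"
    by (intro tendsto_intros)
  then have "p (G b - G a) \<le> \<phi> b - \<phi> a + 0 * (b - a)"
    using eps eventually_at_right_less[of 0]
    by (intro tendsto_lowerbound[of _ _ "at_right (0::real)"]) (auto elim: eventually_mono)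
  then show ?thesis
    by simp
qed

end

section \<open>Antiderivatives of continuous vector-valued functions\<close>

context locally_convex_space
begin

text \<open>
  Right derivatives suffice, because a continuous function is determined by its right derivatives
  up to a constant. They are also what the one-sided limit in the definition of a generator supplies.
\<close>
definition antiderivative :: "real \<Rightarrow> (real \<Rightarrow> 'a) \<Rightarrow> (real \<Rightarrow> 'a) \<Rightarrow> bool" where
  "antiderivative b f G \<longleftrightarrow> G 0 = 0 \<and> continuous_on {0..b} G \<and>
     (\<forall>r. 0 \<le> r \<longrightarrow> r < b \<longrightarrow> right_deriv G (f r) r)"

lemma antiderivative_subinterval:
  "antiderivative b f G \<Longrightarrow> c \<le> b \<Longrightarrow> antiderivative c f G"
  unfolding antiderivative_def by (auto intro: continuous_on_subset)

lemma antiderivative_add: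
  "antiderivative b f G \<Longrightarrow> antiderivative b g H \<Longrightarrow> antiderivative b (\<lambda>s. f s + g s) (\<lambda>s. G s + H s)"
  unfolding antiderivative_def by (auto intro: continuous_intros right_deriv_add)

lemma antiderivative_scale:
  "antiderivative b f G \<Longrightarrow> antiderivative b (\<lambda>s. scl c (f s)) (\<lambda>s. scl c (G s))"
  unfolding antiderivative_def by (auto intro: continuous_intros continuous_on_scale right_deriv_scale)

lemma right_quotient_integral:
  fixes \<phi> :: "real \<Rightarrow> real"
  assumes "continuous_on {0..b} \<phi>" "0 \<le> r" "r < b"
  shows "((\<lambda>h. (integral {0..r + h} \<phi> - integral {0..r} \<phi>) / h) \<longlongrightarrow> \<phi> r) (at_right 0)"
proof -
  have "((\<lambda>u. integral {0..u} \<phi>) has_real_derivative \<phi> r) (at r within {0..b})"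
    using assms by (intro integral_has_real_derivative) auto
  then have "((\<lambda>u. integral {0..u} \<phi>) has_real_derivative \<phi> r) (at r within {r..b})"
    by (rule DERIV_subset) (use assms in auto)
  then have "((\<lambda>u. (integral {0..u} \<phi> - integral {0..r} \<phi>) / (u - r)) \<longlongrightarrow> \<phi> r) (at_right r)"
    using assms by (simp add: has_field_derivative_iff at_within_Icc_at_right)
  then show ?thesis
    unfolding filterlim_at_right_to_0[of _ _ r] by (simp add: add.commute)
qed

text \<open>
  The replacement for the inequality between the norm of an integral and the integral of the norm.
\<close>
lemma seminorm_antiderivative_le:
  fixes \<phi> :: "real \<Rightarrow> real"
  assumes p: "p \<in> \<Gamma>" and G: "antiderivative b f G" and "0 \<le> b" and \<phi>: "continuous_on {0..b} \<phi>"
    and le: "\<And>s. 0 \<le> s \<Longrightarrow> s < b \<Longrightarrow> p (f s) \<le> \<phi> s"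
  shows "p (G b) \<le> integral {0..b} \<phi>"
proof -
  have "p (G b - G 0) \<le> integral {0..b} \<phi> - integral {0..0} \<phi>"
  proof (rule mean_value_inequality[where g = f and \<phi>' = \<phi> and \<phi> = "\<lambda>r. integral {0..r} \<phi>", OF p])
    show "continuous_on {0..b} (\<lambda>r. integral {0..r} \<phi>)"
      using \<phi> by (intro indefinite_integral_continuous_1 integrable_continuous_interval)
  qed (use G le \<phi> \<open>0 \<le> b\<close> in \<open>auto simp: antiderivative_def intro: right_quotient_integral\<close>)
  then show ?thesis
    using G by (simp add: antiderivative_def)
qed

lemma antiderivative_unique:
  assumes "antiderivative b f G" "antiderivative b f H" "0 \<le> b"
  shows "G b = H b"
proof (rule eq_if_seminorms_zero)
  fix p assume p: "p \<in> \<Gamma>"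
  have "antiderivative b (\<lambda>s. f s + scl (-1) (f s)) (\<lambda>s. G s + scl (-1) (H s))"
    using assms by (intro antiderivative_add antiderivative_scale)
  then have "p (G b + scl (-1) (H b)) \<le> integral {0..b} (\<lambda>_. 0)"
    using p assms(3) seminorm_zero[OF p] by (intro seminorm_antiderivative_le[OF p]) auto
  then show "p (G b - H b) = 0"
    using seminorm_nonneg[OF p, of "G b - H b"] by simp
qed

lemma antiderivative_scale_const:
  fixes \<phi> :: "real \<Rightarrow> real"
  assumes "continuous_on {0..b} \<phi>"
  shows "antiderivative b (\<lambda>s. scl (complex_of_real (\<phi> s)) v)
      (\<lambda>s. scl (complex_of_real (integral {0..s} \<phi>)) v)"
  unfolding antiderivative_def
proof (intro conjI allI impI)
  show "continuous_on {0..b} (\<lambda>s. scl (complex_of_real (integral {0..s} \<phi>)) v)"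
    using assms by (intro continuous_on_scale continuous_intros indefinite_integral_continuous_1
      integrable_continuous_interval)
qed (use assms in \<open>auto intro: right_deriv_scale_const right_quotient_integral\<close>)

text \<open>
  Heine's theorem for the real function \<open>p (f r - f s)\<close> on the square, which vanishes on the diagonal.
\<close>
lemma uniformly_continuous_seminorm:
  fixes f :: "real \<Rightarrow> 'a"
  assumes p: "p \<in> \<Gamma>" and f: "continuous_on {0..b} f" and "0 < e"
  obtains d where "0 < d"
    "\<And>r s. r \<in> {0..b} \<Longrightarrow> s \<in> {0..b} \<Longrightarrow> \<bar>r - s\<bar> < d \<Longrightarrow> p (f r - f s) < e"
proof -
  have "continuous_on ({0..b} \<times> {0..b}) (\<lambda>z. f (fst z))" "continuous_on ({0..b} \<times> {0..b}) (\<lambda>z. f (snd z))"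
    by (auto intro!: continuous_on_compose2[OF f] continuous_intros)
  then have "continuous_on ({0..b} \<times> {0..b}) (\<lambda>z. p (f (fst z) - f (snd z)))"
    by (intro continuous_on_seminorm[OF p] continuous_intros)
  then have "uniformly_continuous_on ({0..b} \<times> {0..b}) (\<lambda>z. p (f (fst z) - f (snd z)))"
    by (intro compact_uniformly_continuous compact_Times) auto
  then obtain d where d: "0 < d" "\<And>z w. z \<in> {0..b} \<times> {0..b} \<Longrightarrow> w \<in> {0..b} \<times> {0..b} \<Longrightarrow>
      dist w z < d \<Longrightarrow> dist (p (f (fst w) - f (snd w))) (p (f (fst z) - f (snd z))) < e"
    using \<open>0 < e\<close> unfolding uniformly_continuous_on_def by metis
  show ?thesis
  proof (rule that[OF d(1)])
    fix r s assume "r \<in> {0..b}" "s \<in> {0..b}" "\<bar>r - s\<bar> < d"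
    then show "p (f r - f s) < e"
      using d(2)[of "(s, s)" "(r, s)"] seminorm_zero[OF p] by (simp add: dist_Pair_Pair dist_real_def)
  qed
qed

text \<open>
  The coefficient of \<open>f (j * b / n)\<close> is the length of the part of \<open>{j * b / n..(j + 1) * b / n}\<close> below \<open>r\<close>.
  So the value at \<open>r\<close> is the integral up to \<open>r\<close> of the step function which equals \<open>f (j * b / n)\<close> on that
  interval.
\<close>
definition polygon :: "real \<Rightarrow> (real \<Rightarrow> 'a) \<Rightarrow> nat \<Rightarrow> real \<Rightarrow> 'a" where
  "polygon b f n r = (\<Sum>j<n. scl (complex_of_real (min (b / real n) (max 0 (r - real j * b / real n)))) (f (real j * b / real n)))"

lemma polygon_0: "0 \<le> b \<Longrightarrow> polygon b f n 0 = 0"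
proof -
  assume "0 \<le> b"
  then have "min (b / n) (max 0 (0 - real j * b / n)) = 0" for j
    by (simp add: max.absorb1)
  then show ?thesis
    unfolding polygon_def by simp
qed

lemma continuous_on_polygon: "continuous_on S (polygon b f n)"
  unfolding polygon_def
  by (intro continuous_on_sum continuous_on_scale continuous_intros)

lemma right_deriv_polygon:
  assumes "0 \<le> r" "r < b" "0 < n"
  obtains c where "0 \<le> c" "c \<le> r" "r - c < b / n" "right_deriv (polygon b f n) (f c) r"
proof -
  have b: "0 < b"
    using assms by simp
  \<comment> \<open>Just to the right of \<open>r\<close> only the summand of the mesh interval containing \<open>r\<close> changes.\<close>
  define k where "k = nat \<lfloor>r * n / b\<rfloor>"
  have k: "real k \<le> r * n / b" "r * n / b < real k + 1"
    using assms b by (auto simp: k_def)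
  have kb: "k * b / n \<le> r" "r < (k + 1) * b / n"
    using k b assms(3) by (auto simp: field_simps)
  have "r * n / b < n"
    using assms b by (simp add: divide_less_eq)
  then have "real k < n"
    using k(1) by simp
  then have "k < n"
    by simp
  have weight: "min (b / n) (max 0 (r + h - j * b / n)) - min (b / n) (max 0 (r - j * b / n))
      = (if j = k then h else 0)" if "0 < h" "h < (k + 1) * b / n - r" for h and j :: nat
  proof (cases j k rule: linorder_cases)
    case less
    then have "(real j + 1) * b \<le> k * b"
      using b by (intro mult_right_mono) auto
    then have "(real j + 1) * b / n \<le> k * b / n"
      by (intro divide_right_mono) auto
    then have "j * b / n + b / n \<le> k * b / n"
      by (simp add: add_divide_distrib distrib_right)
    then show ?thesis
      using less that kb b by auto
  next
    case equal
    have "(k + 1) * b / n = k * b / n + b / n"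
      by (simp add: field_simps add_divide_distrib)
    then show ?thesis
      using equal that kb b by auto
  next
    case greater
    then have "(real k + 1) * b \<le> j * b"
      using b by (intro mult_right_mono) auto
    then have "(k + 1) * b / n \<le> j * b / n"
      using assms(3) by (intro divide_right_mono) (simp_all add: add.commute)
    then show ?thesis
      using greater that kb b by auto
  qed
  have "polygon b f n (r + h) - polygon b f n r = scl (complex_of_real h) (f (k * b / n))"
    if h: "0 < h" "h < (k + 1) * b / n - r" for h
  proof -
    have "polygon b f n (r + h) - polygon b f n r
        = (\<Sum>j<n. scl (complex_of_real (if j = k then h else 0)) (f (real j * b / real n)))"
      unfolding polygon_def sum_subtractf[symmetric] scale_left_diff_distrib[symmetric]
        of_real_diff[symmetric] weight[OF h] ..
    also have "\<dots> = (\<Sum>j<n. if j = k then scl (complex_of_real h) (f (k * b / n)) else 0)"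
      by (intro sum.cong) auto
    finally show ?thesis
      using \<open>k < n\<close> by simp
  qed
  then have "eventually (\<lambda>h. scl (complex_of_real (1 / h)) (polygon b f n (r + h) - polygon b f n r)
      = f (k * b / n)) (at_right 0)"
    using kb(2) by (intro eventually_at_rightI[of 0 "(k + 1) * b / n - r"]) auto
  then have "right_deriv (polygon b f n) (f (k * b / n)) r"
    unfolding right_deriv_def by (rule tendsto_eventually)
  then show ?thesis
    using that[of "k * b / n"] kb b by (simp add: field_simps add_divide_distrib)
qed

text \<open>
  The vector \<open>v = 0\<close> gives a Lipschitz bound and \<open>v = f r\<close> compares the polygon with its expected tangent.
  Neither bound depends on \<open>n\<close>, so both pass to the limit of the polygons.
\<close>
lemma polygon_increment_le:
  assumes p: "p \<in> \<Gamma>" and "0 \<le> r" "r \<le> r'" "r' \<le> b" "0 < n" "b / n < d"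
    and le: "\<And>s. 0 \<le> s \<Longrightarrow> s \<le> b \<Longrightarrow> r - d < s \<Longrightarrow> s \<le> r' \<Longrightarrow> p (f s - v) \<le> K"
  shows "p (polygon b f n r' - polygon b f n r - scl (complex_of_real (r' - r)) v) \<le> K * (r' - r)"
proof -
  have "\<exists>c. 0 \<le> c \<and> c \<le> s \<and> s - c < d \<and> right_deriv (polygon b f n) (f c) s"
    if s: "0 \<le> s" "s < b" for s
  proof -
    obtain c where "0 \<le> c" "c \<le> s" "s - c < b / n" "right_deriv (polygon b f n) (f c) s"
      by (rule right_deriv_polygon[OF s \<open>0 < n\<close>])
    then show ?thesis
      using \<open>b / n < d\<close> by (intro exI[of _ c]) auto
  qed
  then obtain c where c: "\<And>s. 0 \<le> s \<Longrightarrow> s < b \<Longrightarrow>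
      0 \<le> c s \<and> c s \<le> s \<and> s - c s < d \<and> right_deriv (polygon b f n) (f (c s)) s"
    by metis
  let ?H = "\<lambda>s. polygon b f n s - scl (complex_of_real s) v"
  have "p (?H r' - ?H r) \<le> K * r' - K * r"
  proof (rule mean_value_inequality[where g = "\<lambda>s. f (c s) - v" and \<phi>' = "\<lambda>_. K" and \<phi> = "\<lambda>s. K * s", OF p \<open>r \<le> r'\<close>])
    show "continuous_on {r..r'} ?H"
      by (intro continuous_intros continuous_on_polygon continuous_on_scale)
    fix s assume s: "r \<le> s" "s < r'"
    have "((\<lambda>h. (s + h - s) / h) \<longlongrightarrow> 1) (at_right (0::real))"
      by (rule tendsto_eventually) (simp add: eventually_at_filter)
    then have "right_deriv (\<lambda>s. scl (complex_of_real s) v) v s"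
      using right_deriv_scale_const[where \<phi> = "\<lambda>s. s" and d = 1] by simp
    then show "right_deriv ?H (f (c s) - v) s"
      using c[of s] s assms by (intro right_deriv_diff) auto
    show "((\<lambda>h. (K * (s + h) - K * s) / h) \<longlongrightarrow> K) (at_right 0)"
      by (rule tendsto_eventually) (simp add: eventually_at_filter algebra_simps)
    show "p (f (c s) - v) \<le> K"
      using c[of s] s assms by (intro le) auto
  qed (intro continuous_intros)
  then show ?thesis
    by (simp add: algebra_simps)
qed

text \<open>
  Two fine polygons have right derivatives which are values of \<open>f\<close> at nearby points, so by uniform
  continuity the right derivative of their difference is small in each seminorm.
\<close>
lemma Cauchy_polygon:
  assumes f: "continuous_on {0..b} f" and "0 \<le> r" "r \<le> b"
  shows "Cauchy (\<lambda>n. polygon b f n r)"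
proof (rule Cauchy_if_seminorms)
  fix p and e :: real assume p: "p \<in> \<Gamma>" and e: "0 < e"
  define e' where "e' = e / (b + 1)"
  have "0 < e'"
    using e assms by (simp add: e'_def)
  then obtain d where d: "0 < d" "\<And>r s. r \<in> {0..b} \<Longrightarrow> s \<in> {0..b} \<Longrightarrow> \<bar>r - s\<bar> < d \<Longrightarrow> p (f r - f s) < e'"
    using uniformly_continuous_seminorm[OF p f] by metis
  obtain N where N: "b / (d / 2) < real N"
    using reals_Archimedean2 by blast
  moreover have "0 \<le> b / (d / 2)"
    using assms d(1) by simp
  ultimately have "0 < real N"
    by linarith
  then have "0 < N"
    by simp
  have mesh: "b / n < d / 2" "0 < n" if "N \<le> n" for n
  proof -
    show "0 < n"
      using that \<open>0 < N\<close> by simp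
    have "b / (d / 2) < real n"
      using N that by (intro less_le_trans[OF N]) simp
    then show "b / n < d / 2"
      using d(1) \<open>0 < n\<close> by (simp add: field_simps)
  qed
  have "p (polygon b f m r - polygon b f n r) < e" if "N \<le> m" "N \<le> n" for m n
  proof -
    have ex: "\<exists>c. 0 \<le> c \<and> c \<le> s \<and> s - c < d / 2 \<and> right_deriv (polygon b f n) (f c) s"
      if s: "0 \<le> s" "s < b" and n: "N \<le> n" for s n
    proof -
      obtain c where "0 \<le> c" "c \<le> s" "s - c < b / n" "right_deriv (polygon b f n) (f c) s"
        by (rule right_deriv_polygon[OF s mesh(2)[OF n]])
      then show ?thesis
        using mesh(1)[OF n] by (intro exI[of _ c] conjI) linarith+
    qed
    define c where "c n s = (SOME c. 0 \<le> c \<and> c \<le> s \<and> s - c < d / 2 \<and> right_deriv (polygon b f n) (f c) s)"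
      for n s
    have c: "0 \<le> c n s \<and> c n s \<le> s \<and> s - c n s < d / 2 \<and> right_deriv (polygon b f n) (f (c n s)) s"
      if "0 \<le> s" "s < b" "N \<le> n" for n s
      unfolding c_def using someI_ex[OF ex[OF that]] .
    let ?H = "\<lambda>s. polygon b f m s - polygon b f n s"
    have "p (?H r - ?H 0) \<le> e' * r - e' * 0"
    proof (rule mean_value_inequality[where g = "\<lambda>s. f (c m s) - f (c n s)" and \<phi>' = "\<lambda>_. e'" and \<phi> = "\<lambda>s. e' * s", OF p \<open>0 \<le> r\<close>])
      fix s assume s: "0 \<le> s" "s < r"
      then show "right_deriv ?H (f (c m s) - f (c n s)) s"
        using c[of s m] c[of s n] that assms by (intro right_deriv_diff) auto
      show "((\<lambda>h. (e' * (s + h) - e' * s) / h) \<longlongrightarrow> e') (at_right 0)"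
        by (rule tendsto_eventually) (simp add: eventually_at_filter algebra_simps)
      show "p (f (c m s) - f (c n s)) \<le> e'"
        using c[of s m] c[of s n] that s assms by (intro less_imp_le d(2)) auto
    qed (intro continuous_intros continuous_on_polygon)+
    moreover have "e' * r \<le> e' * b"
      using assms \<open>0 < e'\<close> by (intro mult_left_mono) auto
    moreover have "e' * b < e"
      using assms e by (simp add: e'_def field_simps)
    ultimately show ?thesis
      using assms by (simp add: polygon_0)
  qed
  then show "\<exists>N. \<forall>m\<ge>N. \<forall>n\<ge>N. p (polygon b f m r - polygon b f n r) < e"
    by blast
qed

end

locale sequentially_complete_lcs = locally_convex_space scl \<Gamma>
  for scl :: "complex \<Rightarrow> 'a::{topological_ab_group_add, uniform_space, t2_space} \<Rightarrow> 'a" and \<Gamma> +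
  assumes sequentially_complete: "\<And>X :: nat \<Rightarrow> 'a. Cauchy X \<Longrightarrow> convergent X"
begin

text \<open>
  The antiderivative is the pointwise limit of the polygons; only countably many approximations are
  used, so sequential completeness is enough.
\<close>
lemma antiderivative_exists:
  assumes f: "continuous_on {0..b} f" and "0 \<le> b"
  shows "\<exists>G. antiderivative b f G"
proof -
  define G where "G r = lim (\<lambda>n. polygon b f n r)" for r
  have G: "(\<lambda>n. polygon b f n r) \<longlonglongrightarrow> G r" if "0 \<le> r" "r \<le> b" for r
    using sequentially_complete[OF Cauchy_polygon[OF f that]] unfolding G_def
    by (simp add: convergent_LIMSEQ_iff)
  have incr: "p (G r' - G r - scl (complex_of_real (r' - r)) v) \<le> K * (r' - r)"
    if p: "p \<in> \<Gamma>" and r: "0 \<le> r" "r \<le> r'" "r' \<le> b" and "0 < d"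
    and le: "\<And>s. 0 \<le> s \<Longrightarrow> s \<le> b \<Longrightarrow> r - d < s \<Longrightarrow> s \<le> r' \<Longrightarrow> p (f s - v) \<le> K" for p r r' v K d
  proof (rule tendsto_upperbound)
    show "(\<lambda>n. p (polygon b f n r' - polygon b f n r - scl (complex_of_real (r' - r)) v))
        \<longlonglongrightarrow> p (G r' - G r - scl (complex_of_real (r' - r)) v)"
      using r by (intro tendsto_seminorm[OF p] tendsto_diff tendsto_const G) auto
    have "(\<lambda>n. b / real n) \<longlonglongrightarrow> 0"
      by (rule lim_const_over_n)
    then have "eventually (\<lambda>n. b / real n < d) sequentially"
      using \<open>0 < d\<close> by (rule order_tendstoD(2))
    then show "eventually (\<lambda>n. p (polygon b f n r' - polygon b f n r - scl (complex_of_real (r' - r)) v)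
        \<le> K * (r' - r)) sequentially"
      using eventually_gt_at_top[of 0]
      by eventually_elim (rule polygon_increment_le[OF p r _ _ le])
  qed simp
  have "antiderivative b f G"
    unfolding antiderivative_def
  proof (intro conjI allI impI)
    show "G 0 = 0"
      using G[of 0] \<open>0 \<le> b\<close> by (simp add: polygon_0 LIMSEQ_const_iff)
    show "continuous_on {0..b} G"
      unfolding continuous_on_def tendsto_iff_seminorms
    proof (intro ballI)
      fix r p assume r: "r \<in> {0..b}" and p: "p \<in> \<Gamma>"
      have "bdd_above ((\<lambda>s. p (f s)) ` {0..b})"
        by (intro bounded_imp_bdd_above compact_imp_bounded compact_continuous_image
            continuous_on_seminorm[OF p] f) auto
      then obtain K where K: "\<And>s. s \<in> {0..b} \<Longrightarrow> p (f s) \<le> K"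
        unfolding bdd_above_def by (metis imageI)
      have K2: "p (G s' - G s) \<le> K * (s' - s)" if "0 \<le> s" "s \<le> s'" "s' \<le> b" for s s'
        using incr[OF p that zero_less_one, of 0 K] K by simp
      have "p (G s - G r) \<le> K * \<bar>s - r\<bar>" if "s \<in> {0..b}" for s
        using K2[of s r] K2[of r s] that r seminorm_minus_commute[OF p, of "G s" "G r"]
        by (cases "s \<le> r") auto
      then have "eventually (\<lambda>s. norm (p (G s - G r)) \<le> K * \<bar>s - r\<bar>) (at r within {0..b})"
        unfolding eventually_at_filter
        by (intro always_eventually) (simp add: seminorm_nonneg[OF p])
      moreover have "((\<lambda>s. K * \<bar>s - r\<bar>) \<longlongrightarrow> 0) (at r within {0..b})"
        by (rule tendsto_eq_intros refl | simp)+
      ultimately show "((\<lambda>s. p (G s - G r)) \<longlongrightarrow> 0) (at r within {0..b})"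
        by (rule Lim_null_comparison)
    qed
    fix r assume r: "0 \<le> r" "r < b"
    show "right_deriv G (f r) r"
      unfolding right_deriv_def tendsto_iff_seminorms
    proof (intro ballI tendstoI)
      fix p and e :: real assume p: "p \<in> \<Gamma>" and "0 < e"
      then obtain d where d: "0 < d" "\<And>r s. r \<in> {0..b} \<Longrightarrow> s \<in> {0..b} \<Longrightarrow> \<bar>r - s\<bar> < d \<Longrightarrow> p (f r - f s) < e / 2"
        using uniformly_continuous_seminorm[OF p f, of "e / 2"] by auto
      have "p (scl (complex_of_real (1 / h)) (G (r + h) - G r) - f r) < e"
        if h: "0 < h" "h < min d (b - r)" for h
      proof -
        have "p (f s - f r) \<le> e / 2" if "0 \<le> s" "s \<le> b" "r - d < s" "s \<le> r + h" for s
          using d(2)[of s r] that r h by (auto simp: abs_less_iff)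
        then have "p (G (r + h) - G r - scl (complex_of_real (r + h - r)) (f r)) \<le> e / 2 * (r + h - r)"
          using h r d(1) by (intro incr[OF p, of _ _ d]) auto
        then have "p (G (r + h) - G r - scl (complex_of_real h) (f r)) \<le> e / 2 * h"
          by simp
        moreover have eq: "scl (complex_of_real (1 / h)) (G (r + h) - G r) - f r
            = scl (complex_of_real (1 / h)) (G (r + h) - G r - scl (complex_of_real h) (f r))"
          using h by (simp add: scale_right_diff_distrib flip: of_real_mult)
        have "p (scl (complex_of_real (1 / h)) (G (r + h) - G r) - f r)
            = p (G (r + h) - G r - scl (complex_of_real h) (f r)) / h"
          unfolding eq seminorm_scale[OF p] using h by (simp add: norm_divide)
        ultimately have "p (scl (complex_of_real (1 / h)) (G (r + h) - G r) - f r) \<le> e / 2"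
          using h by (simp only: divide_le_eq if_True)
        then show ?thesis
          using \<open>0 < e\<close> by linarith
      qed
      then show "eventually (\<lambda>h. dist (p (scl (complex_of_real (1 / h)) (G (r + h) - G r) - f r)) 0 < e)
          (at_right 0)"
        using d(1) r seminorm_nonneg[OF p]
        by (intro eventually_at_rightI[of 0 "min d (b - r)"]) (auto simp: dist_real_def)
    qed
  qed
  then show ?thesis
    by blast
qed

text \<open>
  For \<open>b \<ge> 0\<close> all antiderivatives of \<open>f\<close> agree at \<open>b\<close>, so the choice does not affect the value.
\<close>
definition vec_integral :: "real \<Rightarrow> (real \<Rightarrow> 'a) \<Rightarrow> 'a" where
  "vec_integral b f = (SOME G. antiderivative b f G) b"

lemma vec_integral_eq:
  assumes "antiderivative b f G" "0 \<le> b"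
  shows "vec_integral b f = G b"
  unfolding vec_integral_def using someI[of "antiderivative b f", OF assms(1)] assms
  by (intro antiderivative_unique)

lemma vec_integral_add:
  assumes "continuous_on {0..b} f" "continuous_on {0..b} g" "0 \<le> b"
  shows "vec_integral b (\<lambda>s. f s + g s) = vec_integral b f + vec_integral b g"
proof -
  obtain G H where G: "antiderivative b f G" and H: "antiderivative b g H"
    using assms antiderivative_exists by metis
  show ?thesis
    using vec_integral_eq[OF antiderivative_add[OF G H] assms(3)]
      vec_integral_eq[OF G assms(3)] vec_integral_eq[OF H assms(3)] by simp
qed

lemma vec_integral_scale:
  assumes "continuous_on {0..b} f" "0 \<le> b"
  shows "vec_integral b (\<lambda>s. scl c (f s)) = scl c (vec_integral b f)"
proof -
  obtain G where G: "antiderivative b f G"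
    using assms antiderivative_exists by metis
  show ?thesis
    using vec_integral_eq[OF antiderivative_scale[OF G] assms(2)] vec_integral_eq[OF G assms(2)] by simp
qed

lemma vec_integral_diff:
  assumes "continuous_on {0..b} f" "continuous_on {0..b} g" "0 \<le> b"
  shows "vec_integral b (\<lambda>s. f s - g s) = vec_integral b f - vec_integral b g"
  using vec_integral_add[OF assms(1) continuous_on_scale[OF continuous_on_const assms(2), of "-1"] assms(3)]
    vec_integral_scale[OF assms(2,3), of "-1"]
  by simp

lemma vec_integral_scale_const:
  fixes \<phi> :: "real \<Rightarrow> real"
  assumes "continuous_on {0..b} \<phi>" "0 \<le> b"
  shows "vec_integral b (\<lambda>s. scl (complex_of_real (\<phi> s)) v) = scl (complex_of_real (integral {0..b} \<phi>)) v"
  using vec_integral_eq[OF antiderivative_scale_const[OF assms(1)] assms(2)] .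

lemma seminorm_vec_integral_le:
  fixes \<phi> :: "real \<Rightarrow> real"
  assumes "p \<in> \<Gamma>" "0 \<le> b" "continuous_on {0..b} f" "continuous_on {0..b} \<phi>"
    and "\<And>s. 0 \<le> s \<Longrightarrow> s < b \<Longrightarrow> p (f s) \<le> \<phi> s"
  shows "p (vec_integral b f) \<le> integral {0..b} \<phi>"
proof -
  obtain G where G: "antiderivative b f G"
    using assms(2,3) antiderivative_exists by metis
  then show ?thesis
    using seminorm_antiderivative_le[OF assms(1) G assms(2,4,5)] vec_integral_eq[OF G assms(2)] by simp
qed

end

section \<open>Orbits of a semigroup and their integrals\<close>

locale lcs_semigroup = sequentially_complete_lcs scl \<Gamma>
  for scl :: "complex \<Rightarrow> 'a::{topological_ab_group_add, uniform_space, t2_space} \<Rightarrow> 'a" and \<Gamma> +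
  fixes T :: "real \<Rightarrow> 'a \<Rightarrow> 'a"
  assumes semigroup: "operator_semigroup scl T"
    and strongly_cont: "strongly_continuous T"
    and equicont: "locally_equicontinuous \<Gamma> T"
begin

lemma T_module_hom: "0 \<le> t \<Longrightarrow> module_hom scl scl (T t)"
  using semigroup Vector_Spaces.linear.axioms(3) unfolding operator_semigroup_def by blast

lemma T_add: "0 \<le> t \<Longrightarrow> T t (x + y) = T t x + T t y"
  and T_diff: "0 \<le> t \<Longrightarrow> T t (x - y) = T t x - T t y"
  and T_scale: "0 \<le> t \<Longrightarrow> T t (scl c x) = scl c (T t x)"
  using T_module_hom module_hom.add module_hom.diff module_hom.scale by blast+

lemma T_zero: "0 \<le> t \<Longrightarrow> T t 0 = 0"
  using T_diff[of t 0 0] by simp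

lemma T_0: "T 0 x = x"
  and T_plus: "0 \<le> t \<Longrightarrow> 0 \<le> s \<Longrightarrow> T (t + s) x = T t (T s x)"
  using semigroup unfolding operator_semigroup_def by auto

lemma tendsto_T:
  assumes "0 \<le> t" "(f \<longlongrightarrow> l) F"
  shows "((\<lambda>i. T t (f i)) \<longlongrightarrow> T t l) F"
proof -
  have "continuous_on UNIV (T t)"
    using semigroup assms(1) unfolding operator_semigroup_def by blast
  then show ?thesis
    using assms(2) by (rule continuous_on_tendsto_compose) auto
qed

lemma continuous_on_orbit: "continuous_on {0..b} (\<lambda>s. T s x)"
  using strongly_cont unfolding strongly_continuous_def by (auto intro: continuous_on_subset[of "{0..}"])

lemma equicontE:
  assumes "p \<in> \<Gamma>" "0 \<le> t"
  obtains q C where "q \<in> \<Gamma>" "0 \<le> C" "\<And>s x. 0 \<le> s \<Longrightarrow> s \<le> t \<Longrightarrow> p (T s x) \<le> C * q x"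
  using equicont assms unfolding locally_equicontinuous_def by (metis atLeastAtMost_iff)

lemma right_deriv_T:
  assumes "0 \<le> t" "right_deriv G v r"
  shows "right_deriv (\<lambda>s. T t (G s)) (T t v) r"
  using tendsto_T[OF assms(1) assms(2)[unfolded right_deriv_def]] assms(1)
  unfolding right_deriv_def by (simp add: T_scale T_diff)

text \<open>
  The integral of the orbit over \<open>{h..t + h}\<close> is \<open>T h\<close> applied to the integral over \<open>{0..t}\<close>, and the two
  intervals differ only near their end points. Hence orbit integrals lie in the domain of the generator.
\<close>
lemma difference_quotient_orbit_integral:
  assumes "0 \<le> t"
  shows "(difference_quotient scl T (vec_integral t (\<lambda>s. T s x)) \<longlongrightarrow> T t x - x) (at_right 0)"
proof -
  \<comment> \<open>The extra unit of time leaves room for the shifts by \<open>h < 1\<close>.\<close>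
  obtain G where G: "antiderivative (t + 1) (\<lambda>s. T s x) G"
    using antiderivative_exists[OF continuous_on_orbit] assms by (metis add_nonneg_nonneg zero_le_one)
  then have Gt: "antiderivative t (\<lambda>s. T s x) G"
    by (rule antiderivative_subinterval) simp
  have shift: "T h (G t) = G (t + h) - G h" if h: "0 < h" "h < 1" for h
  proof -
    have "antiderivative t (\<lambda>s. T (s + h) x) (\<lambda>s. T h (G s))"
      using Gt h assms unfolding antiderivative_def
      by (auto simp: T_zero T_plus add.commute[of _ h] continuous_on_def intro: tendsto_T right_deriv_T)
    moreover have "antiderivative t (\<lambda>s. T (s + h) x) (\<lambda>s. G (s + h) - G h)"
      unfolding antiderivative_def
    proof (intro conjI allI impI)
      show "continuous_on {0..t} (\<lambda>s. G (s + h) - G h)"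
        using G h unfolding antiderivative_def
        by (intro continuous_intros continuous_on_compose2[where f = "\<lambda>s. s + h" and g = G and t = "{0..t + 1}"]) auto
      fix r assume "0 \<le> r" "r < t"
      then have "right_deriv G (T (r + h) x) (r + h)"
        using G h unfolding antiderivative_def by auto
      then show "right_deriv (\<lambda>s. G (s + h) - G h) (T (r + h) x) r"
        unfolding right_deriv_def by (simp add: add_ac)
    qed simp
    ultimately show ?thesis
      using assms by (rule antiderivative_unique)
  qed
  have "right_deriv G (T t x) t" "right_deriv G (T 0 x) 0"
    using G assms unfolding antiderivative_def by auto
  then have "((\<lambda>h. scl (complex_of_real (1 / h)) (G (t + h) - G t)
      - scl (complex_of_real (1 / h)) (G (0 + h) - G 0)) \<longlongrightarrow> T t x - T 0 x) (at_right 0)"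
    unfolding right_deriv_def by (rule tendsto_diff)
  moreover have "eventually (\<lambda>h. difference_quotient scl T (G t) h
      = scl (complex_of_real (1 / h)) (G (t + h) - G t)
      - scl (complex_of_real (1 / h)) (G (0 + h) - G 0)) (at_right 0)"
    using G by (intro eventually_at_rightI[of 0 1])
      (auto simp: difference_quotient_def shift antiderivative_def scale_right_diff_distrib)
  ultimately have "(difference_quotient scl T (G t) \<longlongrightarrow> T t x - T 0 x) (at_right 0)"
    by (simp add: tendsto_cong)
  then show ?thesis
    using vec_integral_eq[OF Gt assms] by (simp add: T_0)
qed

text \<open>
  For \<open>x\<close> in the domain, \<open>T s x - x\<close> is an antiderivative in \<open>s\<close> of the orbit of the image of \<open>x\<close> under the
  generator.
\<close>
lemma orbit_increment_eq_integral:
  assumes "0 \<le> t" and y: "(difference_quotient scl T x \<longlongrightarrow> y) (at_right 0)"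
  shows "T t x - x = vec_integral t (\<lambda>s. T s y)"
proof -
  have "right_deriv (\<lambda>s. T s x - x) (T r y) r" if r: "0 \<le> r" for r
  proof -
    have "((\<lambda>h. T r (difference_quotient scl T x h)) \<longlongrightarrow> T r y) (at_right 0)"
      using r y by (rule tendsto_T)
    moreover have "eventually (\<lambda>h. T r (difference_quotient scl T x h)
        = scl (complex_of_real (1 / h)) (T (r + h) x - x - (T r x - x))) (at_right 0)"
      using r by (intro eventually_at_rightI[of 0 1])
        (auto simp: difference_quotient_def T_scale T_diff T_plus)
    ultimately show ?thesis
      unfolding right_deriv_def by (simp add: tendsto_cong)
  qed
  then have "antiderivative t (\<lambda>s. T s y) (\<lambda>s. T s x - x)"
    unfolding antiderivative_def by (auto intro: continuous_intros continuous_on_orbit simp: T_0)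
  then show ?thesis
    using vec_integral_eq assms(1) by metis
qed

lemma generator_eq:
  assumes "(difference_quotient scl T x \<longlongrightarrow> y) (at_right 0)"
  shows "x \<in> generator_domain scl T" "generator scl T x = y"
  using assms unfolding generator_domain_def generator_def by (auto intro: tendsto_Lim)

lemma generator_tendsto:
  assumes "x \<in> generator_domain scl T"
  shows "(difference_quotient scl T x \<longlongrightarrow> generator scl T x) (at_right 0)"
  using assms generator_eq(2) unfolding generator_domain_def by auto

text \<open>
  Passing from \<open>T\<close> to \<open>rescaled \<mu>\<close> replaces the generator \<open>A\<close> by \<open>A - \<mu>\<close>, which reduces all statements
  about the spectral value \<open>\<mu>\<close> to the value \<open>0\<close>.
\<close>
definition rescaled :: "complex \<Rightarrow> real \<Rightarrow> 'a \<Rightarrow> 'a" where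
  "rescaled \<mu> s x = scl (exp (- of_real s * \<mu>)) (T s x)"

lemma lcs_semigroup_rescaled: "lcs_semigroup scl \<Gamma> (rescaled \<mu>)"
proof
  have lin: "Vector_Spaces.linear scl scl (rescaled \<mu> t)" if "0 \<le> t" for t
    using that by unfold_locales (simp_all add: rescaled_def T_add T_scale scale_right_distrib mult.commute)
  have "continuous_on UNIV (rescaled \<mu> t)" if t: "0 \<le> t" for t
  proof -
    have "continuous_on UNIV (T t)"
      using semigroup t unfolding operator_semigroup_def by blast
    then show ?thesis
      unfolding rescaled_def by (intro continuous_on_scale continuous_intros)
  qed
  moreover have "rescaled \<mu> 0 = id"
    by (auto simp: rescaled_def T_0)
  moreover have "rescaled \<mu> (t + s) = rescaled \<mu> t \<circ> rescaled \<mu> s" if "0 \<le> t" "0 \<le> s" for t s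
    using that by (auto simp: rescaled_def T_plus T_scale ring_distribs exp_add[symmetric] fun_eq_iff)
  ultimately show "operator_semigroup scl (rescaled \<mu>)"
    using lin unfolding operator_semigroup_def by blast
  show "strongly_continuous (rescaled \<mu>)"
    using strongly_cont unfolding strongly_continuous_def rescaled_def
    by (auto intro!: continuous_on_scale continuous_intros)
  show "locally_equicontinuous \<Gamma> (rescaled \<mu>)"
    unfolding locally_equicontinuous_def
  proof (intro ballI allI impI)
    fix p and t :: real assume p: "p \<in> \<Gamma>" and "0 \<le> t"
    then obtain q C where q: "q \<in> \<Gamma>" "0 \<le> C" "\<And>s x. 0 \<le> s \<Longrightarrow> s \<le> t \<Longrightarrow> p (T s x) \<le> C * q x"
      by (rule equicontE) blast
    have "p (rescaled \<mu> s x) \<le> exp (t * cmod \<mu>) * C * q x" if s: "0 \<le> s" "s \<le> t" for s x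
    proof -
      have "cmod (exp (- of_real s * \<mu>)) \<le> exp (cmod (- of_real s * \<mu>))"
        by (rule norm_exp)
      also have "\<dots> \<le> exp (t * cmod \<mu>)"
        using s by (simp add: norm_mult mult_right_mono)
      finally have "cmod (exp (- of_real s * \<mu>)) * p (T s x) \<le> exp (t * cmod \<mu>) * (C * q x)"
        using q(3)[OF s] seminorm_nonneg[OF p] by (intro mult_mono) auto
      then show ?thesis
        by (simp add: rescaled_def seminorm_scale[OF p] mult.assoc)
    qed
    then show "\<exists>q\<in>\<Gamma>. \<exists>C\<ge>0. \<forall>s\<in>{0..t}. \<forall>x. p (rescaled \<mu> s x) \<le> C * q x"
      using q(1,2) by (intro bexI[of _ q] exI[of _ "exp (t * cmod \<mu>) * C"]) auto
  qed
qed

lemma difference_quotient_rescaled: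
  assumes "(difference_quotient scl T x \<longlongrightarrow> y) (at_right 0)"
  shows "(difference_quotient scl (rescaled \<mu>) x \<longlongrightarrow> y - scl \<mu> x) (at_right 0)"
proof -
  have "((\<lambda>z. exp (- z * \<mu>)) has_field_derivative - \<mu>) (at 0)"
    by (auto intro!: derivative_eq_intros)
  then have "((\<lambda>z. (exp (- z * \<mu>) - 1) / z) \<longlongrightarrow> - \<mu>) (at 0)"
    unfolding has_field_derivative_iff by simp
  moreover have "filterlim complex_of_real (at 0) (at_right 0)"
    unfolding filterlim_at by (auto intro!: tendsto_eq_intros simp: eventually_at_filter)
  ultimately have exp_quotient:
    "((\<lambda>h. (exp (- complex_of_real h * \<mu>) - 1) / complex_of_real h) \<longlongrightarrow> - \<mu>) (at_right 0)"
    by (rule filterlim_compose)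
  have "((\<lambda>h. exp (- complex_of_real h * \<mu>)) \<longlongrightarrow> exp (- complex_of_real 0 * \<mu>)) (at_right 0)"
    by (intro tendsto_intros)
  then have "((\<lambda>h. scl (exp (- complex_of_real h * \<mu>)) (difference_quotient scl T x h)
      + scl ((exp (- complex_of_real h * \<mu>) - 1) / complex_of_real h) x)
      \<longlongrightarrow> scl (exp (- complex_of_real 0 * \<mu>)) y + scl (- \<mu>) x) (at_right 0)"
    using assms exp_quotient by (intro tendsto_add tendsto_scale tendsto_const)
  moreover have "scl (exp (- complex_of_real h * \<mu>)) (difference_quotient scl T x h)
      + scl ((exp (- complex_of_real h * \<mu>) - 1) / complex_of_real h) x
      = difference_quotient scl (rescaled \<mu>) x h" for h
    by (simp add: difference_quotient_def rescaled_def scale_right_diff_distrib scale_left_diff_distrib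
        diff_divide_distrib mult.commute)
  ultimately show ?thesis
    by simp
qed

end

section \<open>Recovering a precompact family from the Fourier coefficients of its orbits\<close>

context lcs_semigroup
begin

lemma bounded_orbits:
  assumes "lcs_bounded \<Gamma> S" "p \<in> \<Gamma>" "0 \<le> t"
  obtains K where "0 \<le> K" "\<And>s x. 0 \<le> s \<Longrightarrow> s \<le> t \<Longrightarrow> x \<in> S \<Longrightarrow> p (T s x) \<le> K"
proof -
  obtain q C where q: "q \<in> \<Gamma>" "0 \<le> C" "\<And>s x. 0 \<le> s \<Longrightarrow> s \<le> t \<Longrightarrow> p (T s x) \<le> C * q x"
    using assms(2,3) by (rule equicontE) blast
  obtain B where B: "\<And>x. x \<in> S \<Longrightarrow> q x \<le> B"
    using assms(1) q(1) unfolding lcs_bounded_def by blast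
  have "p (T s x) \<le> C * \<bar>B\<bar>" if "0 \<le> s" "s \<le> t" "x \<in> S" for s x
  proof -
    have "C * q x \<le> C * \<bar>B\<bar>"
      using q(2) B[OF that(3)] by (intro mult_left_mono) auto
    then show ?thesis
      using q(3)[OF that(1,2), of x] by linarith
  qed
  then show ?thesis
    using that[of "C * \<bar>B\<bar>"] q(2) by auto
qed

text \<open>
  Precompactness enters here: equicontinuity transfers the continuity of finitely many orbits to all
  orbits that start in \<open>S\<close>, with a common \<open>d\<close>.
\<close>
lemma uniformly_continuous_at_0:
  assumes "totally_bounded S" "p \<in> \<Gamma>" "0 < e"
  obtains d where "0 < d" "\<And>s x. 0 \<le> s \<Longrightarrow> s < d \<Longrightarrow> x \<in> S \<Longrightarrow> p (T s x - x) \<le> e"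
proof -
  \<comment> \<open>At \<open>s = 0\<close> this also bounds \<open>p\<close> itself by \<open>C * q\<close>.\<close>
  obtain q C where q: "q \<in> \<Gamma>" "0 \<le> C" "\<And>s x. 0 \<le> s \<Longrightarrow> s \<le> 1 \<Longrightarrow> p (T s x) \<le> C * q x"
    using assms(2) zero_le_one by (rule equicontE) blast
  have "0 < e / (4 * (C + 1))"
    using assms(3) q(2) by simp
  then obtain Y where Y: "finite Y" "\<And>x. x \<in> S \<Longrightarrow> \<exists>y\<in>Y. q (x - y) < e / (4 * (C + 1))"
    using totally_bounded_seminormE[OF assms(1) q(1)] by metis
  have "eventually (\<lambda>s. p (T s y - y) < e / 2) (at 0 within {0..1})" for y
  proof -
    have "((\<lambda>s. T s y) \<longlongrightarrow> T 0 y) (at 0 within {0..1})"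
      using continuous_on_orbit[of 1 y] unfolding continuous_on_def by simp
    then have "((\<lambda>s. p (T s y - y)) \<longlongrightarrow> 0) (at 0 within {0..1})"
      using assms(2) unfolding tendsto_iff_seminorms by (simp add: T_0)
    then show ?thesis
      using assms(3) by (intro order_tendstoD(2)) auto
  qed
  then have "eventually (\<lambda>s. \<forall>y\<in>Y. p (T s y - y) < e / 2) (at 0 within {0..1})"
    using Y(1) by (simp add: eventually_ball_finite)
  then obtain d where d: "0 < d"
    "\<And>s y. s \<in> {0..1} \<Longrightarrow> s \<noteq> 0 \<Longrightarrow> dist s 0 < d \<Longrightarrow> y \<in> Y \<Longrightarrow> p (T s y - y) < e / 2"
    unfolding eventually_at by metis
  show ?thesis
  proof (rule that[of "min d 1"])
    fix s x assume s: "0 \<le> s" "s < min d 1" and "x \<in> S"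
    then obtain y where y: "y \<in> Y" "q (x - y) < e / (4 * (C + 1))"
      using Y(2) by blast
    have C: "C * q (x - y) \<le> e / 4"
    proof -
      have "C * q (x - y) \<le> (C + 1) * (e / (4 * (C + 1)))"
        using y(2) q(2) seminorm_nonneg[OF q(1)] by (intro mult_mono) auto
      also have "\<dots> = e / 4"
        using q(2) by (simp add: field_simps)
      finally show ?thesis .
    qed
    have "p (T s y - y) < e / 2"
      using d(2)[of s y] y(1) s assms(3) seminorm_zero[OF assms(2)] by (cases "s = 0") (auto simp: T_0)
    moreover have "p (T s (x - y)) \<le> e / 4" "p (T 0 (x - y)) \<le> e / 4"
      using q(3)[of s "x - y"] q(3)[of 0 "x - y"] s C by auto
    moreover have "p (T s x - x) \<le> p (T s (x - y)) + p (T s y - x)"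
      using seminorm_diff_le[OF assms(2), of "T s x" x "T s y"] s by (simp add: T_diff)
    moreover have "p (T s y - x) \<le> p (T s y - y) + p (x - y)"
      using seminorm_diff_le[OF assms(2), of "T s y" x y] seminorm_minus_commute[OF assms(2), of x y] by simp
    ultimately show "p (T s x - x) \<le> e"
      by (simp add: T_0)
  qed (use d(1) in auto)
qed

text \<open>
  Call \<open>g\<close> good if all its products with the characters \<open>\<omega> n\<close> have moments tending to \<open>0\<close>. Multiplication
  by a real-linear function of \<open>\<omega> 1\<close> combines shifts of \<open>n\<close> by \<open>1\<close> and \<open>- 1\<close>, so it preserves goodness. The
  multipliers that do so form an algebra, and hence contain all real polynomials in \<open>\<omega> 1\<close>.
\<close>
lemma vanishing_trigonometric_moments:
  fixes x :: "'i \<Rightarrow> 'a"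
  assumes "0 < t"
    and coeff: "\<And>n :: int. ((\<lambda>i. vec_integral t (\<lambda>s. scl (cis (2 * pi * n * s / t)) (T s (x i)))) \<longlongrightarrow> 0) F"
    and "real_polynomial_function u"
  shows "((\<lambda>i. vec_integral t (\<lambda>s. scl (complex_of_real (u (cis (2 * pi * s / t)))) (T s (x i)))) \<longlongrightarrow> 0) F"
proof -
  define J where "J g i = vec_integral t (\<lambda>s. scl (g s) (T s (x i)))" for g i
  define \<omega> where "\<omega> n s = cis (2 * pi * of_int n * s / t)" for n :: int and s
  define good where "good g \<longleftrightarrow> continuous_on {0..t} g \<and> (\<forall>n. (J (\<lambda>s. \<omega> n s * g s) \<longlongrightarrow> 0) F)" for g
  have cont_\<omega>: "continuous_on {0..t} (\<omega> n)" for n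
    unfolding \<omega>_def cis_conv_exp using assms(1) by (intro continuous_intros) auto
  have \<omega>_up: "\<omega> (n + 1) s = \<omega> n s * \<omega> 1 s" and \<omega>_down: "\<omega> (n - 1) s = \<omega> n s * cnj (\<omega> 1 s)" for n s
    unfolding \<omega>_def by (simp_all add: cis_mult cis_cnj ring_distribs add_divide_distrib diff_divide_distrib)
  have good_lin: "good (\<lambda>s. a * g s + b * h s)"
    if "\<And>n. ((\<lambda>i. J (\<lambda>s. \<omega> n s * g s) i) \<longlongrightarrow> 0) F" "\<And>n. ((\<lambda>i. J (\<lambda>s. \<omega> n s * h s) i) \<longlongrightarrow> 0) F"
      "continuous_on {0..t} g" "continuous_on {0..t} h" for a b g h
    unfolding good_def
  proof (intro conjI allI)
    show "continuous_on {0..t} (\<lambda>s. a * g s + b * h s)"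
      using that by (intro continuous_intros)
    fix n
    have "J (\<lambda>s. \<omega> n s * (a * g s + b * h s)) i
        = scl a (J (\<lambda>s. \<omega> n s * g s) i) + scl b (J (\<lambda>s. \<omega> n s * h s) i)" for i
    proof -
      have cont: "continuous_on {0..t} (\<lambda>s. scl (\<omega> n s * g s) (T s (x i)))"
        "continuous_on {0..t} (\<lambda>s. scl (\<omega> n s * h s) (T s (x i)))"
        using that by (auto intro!: continuous_on_scale continuous_intros cont_\<omega> continuous_on_orbit)
      have "J (\<lambda>s. \<omega> n s * (a * g s + b * h s)) i = vec_integral t
          (\<lambda>s. scl a (scl (\<omega> n s * g s) (T s (x i))) + scl b (scl (\<omega> n s * h s) (T s (x i))))"
        unfolding J_def by (simp add: scale_left_distrib[symmetric] ring_distribs mult_ac)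
      also have "\<dots> = vec_integral t (\<lambda>s. scl a (scl (\<omega> n s * g s) (T s (x i))))
          + vec_integral t (\<lambda>s. scl b (scl (\<omega> n s * h s) (T s (x i))))"
        using assms(1) by (intro vec_integral_add continuous_on_scale[OF continuous_on_const] cont) simp
      also have "\<dots> = scl a (J (\<lambda>s. \<omega> n s * g s) i) + scl b (J (\<lambda>s. \<omega> n s * h s) i)"
        unfolding J_def using assms(1) by (simp only: vec_integral_scale[OF cont(1)] vec_integral_scale[OF cont(2)] less_imp_le)
      finally show ?thesis .
    qed
    then have "J (\<lambda>s. \<omega> n s * (a * g s + b * h s))
        = (\<lambda>i. scl a (J (\<lambda>s. \<omega> n s * g s) i) + scl b (J (\<lambda>s. \<omega> n s * h s) i))"
      by (rule ext)
    moreover have "((\<lambda>i. scl a (J (\<lambda>s. \<omega> n s * g s) i) + scl b (J (\<lambda>s. \<omega> n s * h s) i))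
        \<longlongrightarrow> scl a 0 + scl b 0) F"
      using that by (intro tendsto_add tendsto_scale tendsto_const)
    ultimately show "(J (\<lambda>s. \<omega> n s * (a * g s + b * h s)) \<longlongrightarrow> 0) F"
      by simp
  qed
  have good_mult: "good (\<lambda>s. complex_of_real (v (\<omega> 1 s)) * g s)"
    if "real_polynomial_function v" "good g" for v g
    using that
  proof (induction v arbitrary: g rule: real_polynomial_function.induct)
    case (linear v)
    define a where "a = (complex_of_real (v 1) - \<i> * complex_of_real (v \<i>)) / 2"
    define b where "b = (complex_of_real (v 1) + \<i> * complex_of_real (v \<i>)) / 2"
    have v: "complex_of_real (v z) = a * z + b * cnj z" for z
    proof -
      interpret bounded_linear v by fact
      have "v z = v (Re z *\<^sub>R 1 + Im z *\<^sub>R \<i>)"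
        by (rule arg_cong[of _ _ v]) (simp add: complex_eq_iff)
      then have "v z = Re z * v 1 + Im z * v \<i>"
        by (simp only: add scaleR real_scaleR_def)
      then show ?thesis
        by (simp add: a_def b_def complex_eq_iff field_simps)
    qed
    have "(J (\<lambda>s. \<omega> n s * (\<omega> 1 s * g s)) \<longlongrightarrow> 0) F" "(J (\<lambda>s. \<omega> n s * (cnj (\<omega> 1 s) * g s)) \<longlongrightarrow> 0) F" for n
      using linear(2) unfolding good_def mult.assoc[symmetric] \<omega>_up[symmetric] \<omega>_down[symmetric] by blast+
    moreover have "continuous_on {0..t} (\<lambda>s. \<omega> 1 s * g s)" "continuous_on {0..t} (\<lambda>s. cnj (\<omega> 1 s) * g s)"
      using linear(2) cont_\<omega> unfolding good_def by (auto intro!: continuous_intros)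
    ultimately have "good (\<lambda>s. a * (\<omega> 1 s * g s) + b * (cnj (\<omega> 1 s) * g s))"
      by (intro good_lin) auto
    then show ?case
      by (simp add: v ring_distribs mult.assoc)
  next
    case (const c)
    then show ?case
      using good_lin[of g g "complex_of_real c" 0] unfolding good_def by simp
  next
    case (add v w)
    from add.IH[OF add.prems] show ?case
      using good_lin[of "\<lambda>s. complex_of_real (v (\<omega> 1 s)) * g s" "\<lambda>s. complex_of_real (w (\<omega> 1 s)) * g s" 1 1]
      unfolding good_def by (simp add: ring_distribs)
  next
    case (mult v w)
    from mult.IH(1)[OF mult.IH(2)[OF mult.prems]] show ?case
      by (simp add: mult.assoc)
  qed
  have "good (\<lambda>_. 1)"
    unfolding good_def using coeff by (simp add: J_def[abs_def] \<omega>_def)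
  from good_mult[OF assms(3) this]
  have "(J (\<lambda>s. \<omega> 0 s * (complex_of_real (u (\<omega> 1 s)) * 1)) \<longlongrightarrow> 0) F"
    unfolding good_def by blast
  then show ?thesis
    by (simp add: J_def[abs_def] \<omega>_def)
qed

text \<open>
  Integrating the orbit of \<open>x i\<close> against a bump near time \<open>0\<close> gives nearly a positive multiple of \<open>x i\<close>,
  because the orbits are uniformly continuous at \<open>0\<close>. The bump is taken to be a function on the circle, so
  it is a uniform limit of trigonometric polynomials, and the integral is also small in the limit.
\<close>
lemma tendsto_0_if_fourier_coefficients_tendsto_0:
  fixes x :: "'i \<Rightarrow> 'a"
  assumes "0 < t" and bdd: "lcs_bounded \<Gamma> (x ` I)" and tb: "totally_bounded (x ` I)"
    and I: "eventually (\<lambda>i. i \<in> I) F"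
    and coeff: "\<And>n :: int. ((\<lambda>i. vec_integral t (\<lambda>s. scl (cis (2 * pi * n * s / t)) (T s (x i)))) \<longlongrightarrow> 0) F"
  shows "(x \<longlongrightarrow> 0) F"
  unfolding tendsto_iff_seminorms
proof (intro ballI tendstoI)
  fix p and e :: real assume p: "p \<in> \<Gamma>" and "0 < e"
  define c where "c s = cis (2 * pi * s / t)" for s
  have cont_c: "continuous_on A c" for A
    unfolding c_def cis_conv_exp using assms(1) by (intro continuous_intros) auto
  have c1: "cmod (c s) = 1" for s
    by (simp add: c_def)
  obtain K where K: "0 \<le> K" "\<And>s x'. 0 \<le> s \<Longrightarrow> s \<le> t \<Longrightarrow> x' \<in> x ` I \<Longrightarrow> p (T s x') \<le> K"
    using bounded_orbits[OF bdd p] assms(1) by (metis less_imp_le)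
  have "0 < e / 3"
    using \<open>0 < e\<close> by simp
  then obtain d0 where d0: "0 < d0" "\<And>s x'. 0 \<le> s \<Longrightarrow> s < d0 \<Longrightarrow> x' \<in> x ` I \<Longrightarrow> p (T s x' - x') \<le> e / 3"
    using uniformly_continuous_at_0[OF tb p] by metis
  define d where "d = min d0 t"
  \<comment> \<open>The bump is centred inside \<open>{0<..<d}\<close>: the centre \<open>z0\<close> is attained at no time in \<open>{d..t}\<close>, and in particular not at \<open>t\<close>.\<close>
  define z0 where "z0 = c (d / 2)"
  have d: "0 < d" "d \<le> t" "d \<le> d0"
    using d0(1) assms(1) by (auto simp: d_def)
  have z0: "z0 \<notin> c ` {d..t}"
  proof
    assume "z0 \<in> c ` {d..t}"
    then obtain s where s: "d \<le> s" "s \<le> t" "cis (2 * pi * s / t) = cis (2 * pi * (d / 2) / t)"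
      by (auto simp: c_def z0_def)
    then have "cis (2 * pi * s / t - 2 * pi * (d / 2) / t) = 1"
      by (simp add: cis_divide[symmetric])
    then have "cos (2 * pi * s / t - 2 * pi * (d / 2) / t) = 1"
      by (simp add: complex_eq_iff)
    moreover define q where "q = (s - d / 2) / t"
    moreover have "2 * pi * s / t - 2 * pi * (d / 2) / t = 2 * pi * q"
      by (simp add: q_def diff_divide_distrib right_diff_distrib)
    ultimately obtain n :: int where "2 * pi * q = of_int n * 2 * pi"
      by (auto simp: cos_one_2pi_int)
    then have "q = of_int n"
      by simp
    moreover have "0 < q" "q < 1"
      using s d assms(1) by (auto simp: q_def field_simps)
    ultimately have "0 < real_of_int n" "real_of_int n < 1"
      by auto
    then show False
      by simp
  qed
  moreover have "compact (c ` {d..t})"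
    by (intro compact_continuous_image cont_c) auto
  ultimately obtain \<rho> where \<rho>: "0 < \<rho>" "\<And>s. d \<le> s \<Longrightarrow> s \<le> t \<Longrightarrow> \<rho> \<le> dist z0 (c s)"
    using separate_point_closed[of "c ` {d..t}" z0] compact_imp_closed by force
  define bump where "bump z = max 0 (\<rho> - dist z0 z)" for z
  have cont_bump: "continuous_on A bump" for A
    unfolding bump_def by (intro continuous_intros)
  define g where "g s = bump (c s)" for s
  have cont_g: "continuous_on A g" for A
    unfolding g_def by (rule continuous_on_compose2[OF cont_bump cont_c]) auto
  have g: "0 \<le> g s" and g_far: "d \<le> s \<Longrightarrow> s \<le> t \<Longrightarrow> g s = 0" and g_mid: "g (d / 2) = \<rho>" for s
    using \<rho>(1) \<rho>(2)[of s] by (auto simp: g_def bump_def z0_def)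
  define m where "m = integral {0..t} g"
  have "m \<noteq> 0"
    unfolding m_def using integral_eq_0_iff[OF cont_g assms(1)] g g_mid \<rho>(1) d by force
  moreover have "0 \<le> m"
    unfolding m_def by (intro integral_nonneg integrable_continuous_interval cont_g) (auto simp: g)
  ultimately have m: "0 < m"
    by simp
  \<comment> \<open>Small enough for an approximation error \<open>\<eta>\<close> of the bump to contribute at most \<open>(e / 3) * m\<close>.\<close>
  define \<eta> where "\<eta> = (e / 3) * m / (K * t + 1)"
  have "0 < K * t + 1"
    using K(1) assms(1) by (simp add: add_nonneg_pos)
  then have \<eta>: "0 < \<eta>" "\<eta> * K * t \<le> (e / 3) * m"
  proof -
    show "0 < \<eta>"
      using \<open>0 < K * t + 1\<close> m \<open>0 < e\<close> by (simp add: \<eta>_def)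
    then have "\<eta> * K * t \<le> \<eta> * (K * t + 1)"
      by (simp add: algebra_simps)
    also have "\<eta> * (K * t + 1) = (e / 3) * m"
      using \<open>0 < K * t + 1\<close> unfolding \<eta>_def by (metis less_irrefl nonzero_eq_divide_eq)
    finally show "\<eta> * K * t \<le> (e / 3) * m" .
  qed
  obtain u where u: "real_polynomial_function u" "\<And>z. z \<in> sphere 0 1 \<Longrightarrow> \<bar>bump z - u z\<bar> < \<eta>"
    using Stone_Weierstrass_real_polynomial_function[OF compact_sphere cont_bump \<eta>(1)] by metis
  have cont_u: "continuous_on {0..t} (\<lambda>s. u (c s))"
    by (rule continuous_on_compose2[OF continuous_on_polymonial_function[of u UNIV] cont_c])
      (use u(1) in \<open>auto simp: real_polynomial_function_eq\<close>)
  have "((\<lambda>i. vec_integral t (\<lambda>s. scl (complex_of_real (u (c s))) (T s (x i)))) \<longlongrightarrow> 0) F"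
    unfolding c_def using assms(1) coeff u(1) by (rule vanishing_trigonometric_moments)
  then have "((\<lambda>i. p (vec_integral t (\<lambda>s. scl (complex_of_real (u (c s))) (T s (x i))))) \<longlongrightarrow> p 0) F"
    by (rule tendsto_seminorm[OF p])
  moreover have "p 0 < (e / 3) * m"
    using \<open>0 < e\<close> m by (simp add: seminorm_zero[OF p])
  ultimately have "eventually (\<lambda>i. p (vec_integral t (\<lambda>s. scl (complex_of_real (u (c s))) (T s (x i)))) < (e / 3) * m) F"
    by (rule order_tendstoD(2))
  then show "eventually (\<lambda>i. dist (p (x i - 0)) 0 < e) F"
    using I
  proof eventually_elim
    case (elim i)
    let ?Jg = "vec_integral t (\<lambda>s. scl (complex_of_real (g s)) (T s (x i)))"
    let ?Ju = "vec_integral t (\<lambda>s. scl (complex_of_real (u (c s))) (T s (x i)))"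
    have xi: "x i \<in> x ` I"
      using elim(2) by simp
    have cont: "continuous_on {0..t} (\<lambda>s. scl (complex_of_real (g s)) (T s (x i)))"
      "continuous_on {0..t} (\<lambda>s. scl (complex_of_real (u (c s))) (T s (x i)))"
      "continuous_on {0..t} (\<lambda>s. scl (complex_of_real (g s)) (x i))"
      by (intro continuous_on_scale continuous_on_of_real continuous_on_const continuous_on_orbit cont_g cont_u)+
    have "p (vec_integral t (\<lambda>s. scl (complex_of_real (g s)) (T s (x i)) - scl (complex_of_real (g s)) (x i)))
        \<le> integral {0..t} (\<lambda>s. g s * (e / 3))"
    proof (rule seminorm_vec_integral_le[OF p])
      fix s assume s: "0 \<le> s" "s < t"
      have "p (scl (complex_of_real (g s)) (T s (x i)) - scl (complex_of_real (g s)) (x i)) = g s * p (T s (x i) - x i)"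
        using g by (simp add: seminorm_scale[OF p] flip: scale_right_diff_distrib)
      also have "\<dots> \<le> g s * (e / 3)"
      proof (cases "s < d")
        case True
        then show ?thesis
          using d0(2)[of s "x i"] xi s d g by (intro mult_left_mono) auto
      next
        case False
        then show ?thesis
          using g_far[of s] s by simp
      qed
      finally show "p (scl (complex_of_real (g s)) (T s (x i)) - scl (complex_of_real (g s)) (x i)) \<le> g s * (e / 3)" .
    qed (use assms(1) cont cont_g in \<open>auto intro!: continuous_intros\<close>)
    then have 1: "p (?Jg - scl (complex_of_real m) (x i)) \<le> m * (e / 3)"
      using cont assms(1) cont_g by (simp add: vec_integral_diff vec_integral_scale_const m_def)
    have "p (vec_integral t (\<lambda>s. scl (complex_of_real (g s)) (T s (x i)) - scl (complex_of_real (u (c s))) (T s (x i))))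
        \<le> integral {0..t} (\<lambda>s. \<eta> * K)"
    proof (rule seminorm_vec_integral_le[OF p])
      fix s assume s: "0 \<le> s" "s < t"
      have "p (scl (complex_of_real (g s)) (T s (x i)) - scl (complex_of_real (u (c s))) (T s (x i)))
          = \<bar>g s - u (c s)\<bar> * p (T s (x i))"
        by (simp add: seminorm_scale[OF p] flip: scale_left_diff_distrib of_real_diff)
      also have "\<dots> \<le> \<eta> * K"
        using u(2)[of "c s"] K(2)[OF _ _ xi, of s] s c1 seminorm_nonneg[OF p] \<eta>(1)
        by (intro mult_mono) (auto simp: g_def)
      finally show "p (scl (complex_of_real (g s)) (T s (x i)) - scl (complex_of_real (u (c s))) (T s (x i))) \<le> \<eta> * K" .
    qed (use assms(1) cont in \<open>auto intro!: continuous_intros\<close>)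
    then have 2: "p (?Jg - ?Ju) \<le> (e / 3) * m"
      using cont assms(1) \<eta>(2) by (simp add: vec_integral_diff mult_ac)
    have "m * p (x i) = p (scl (complex_of_real m) (x i) - 0)"
      using m by (simp add: seminorm_scale[OF p])
    also have "\<dots> \<le> p (?Jg - scl (complex_of_real m) (x i)) + p (?Jg - ?Ju) + p ?Ju"
      using seminorm_diff_le[OF p, of "scl (complex_of_real m) (x i)" 0 ?Jg]
        seminorm_diff_le[OF p, of ?Jg 0 ?Ju] seminorm_minus_commute[OF p, of ?Jg "scl (complex_of_real m) (x i)"] by simp
    also have "\<dots> < m * e"
      using 1 2 elim(1) by (simp add: field_simps)
    finally show ?case
      using m seminorm_nonneg[OF p] by simp
  qed
qed

end

section \<open>The spectral mapping theorem\<close>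

context locally_convex_space
begin

text \<open>
  The common form of both spectra, for one index set and one filter. The arguments below turn a
  family of vectors into another one with the same indices, so they apply to nets and to sequences alike.
\<close>
definition bap_values :: "'i filter \<Rightarrow> 'i set \<Rightarrow> 'a set \<Rightarrow> ('a \<Rightarrow> 'a) \<Rightarrow> complex set" where
  "bap_values F I D B = {\<mu>. \<exists>x. x ` I \<subseteq> D \<and> lcs_bounded \<Gamma> (x ` I) \<and>
     \<not> (x \<longlongrightarrow> 0) F \<and> ((\<lambda>i. B (x i) - scl \<mu> (x i)) \<longlongrightarrow> 0) F}"

lemma sigma_bap_eq_bap_values:
  "sigma_bap scl \<Gamma> D B = {\<mu>. \<exists>(I :: 'a set set) le. directed_set I le \<and> \<mu> \<in> bap_values (tails I le) I D B}"
  unfolding sigma_bap_def bap_values_def by blast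

lemma sigma_bap_seq_eq_bap_values: "sigma_bap_seq scl \<Gamma> D B = bap_values sequentially UNIV D B"
  unfolding sigma_bap_seq_def bap_values_def by simp

lemma bap_values_id: "bap_values F I UNIV id \<subseteq> {1}"
proof
  fix \<mu> assume "\<mu> \<in> bap_values F I UNIV id"
  then obtain x :: "'b \<Rightarrow> 'a" where x: "\<not> (x \<longlongrightarrow> 0) F" "((\<lambda>i. x i - scl \<mu> (x i)) \<longlongrightarrow> 0) F"
    unfolding bap_values_def by auto
  show "\<mu> \<in> {1}"
  proof (rule ccontr)
    assume "\<mu> \<notin> {1}"
    then have "x i = scl (1 / (1 - \<mu>)) (scl (1 - \<mu>) (x i))" for i
      by simp
    then have "x i = scl (1 / (1 - \<mu>)) (x i - scl \<mu> (x i))" for i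
      by (simp only: scale_left_diff_distrib scale_one)
    moreover have "((\<lambda>i. scl (1 / (1 - \<mu>)) (x i - scl \<mu> (x i))) \<longlongrightarrow> scl (1 / (1 - \<mu>)) 0) F"
      using x(2) by (intro tendsto_scale tendsto_const)
    ultimately show False
      using x(1) by simp
  qed
qed

lemma one_in_bap_values_id:
  "bap_values F I D B \<noteq> {} \<Longrightarrow> 1 \<in> bap_values F I UNIV id"
  unfolding bap_values_def by auto

end

context lcs_semigroup
begin

text \<open>
  For \<open>S = rescaled \<mu>\<close> the increment \<open>S t (x i) - x i\<close> is the integral of the orbit of \<open>A (x i) - \<mu> (x i)\<close>
  under \<open>S\<close>, where \<open>A\<close> is the generator of \<open>T\<close>. By equicontinuity it tends to \<open>0\<close>.
\<close>
lemma approximate_eigenvectors_of_semigroup: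
  assumes "0 \<le> t" and I: "eventually (\<lambda>i. i \<in> I) F" and D: "x ` I \<subseteq> generator_domain scl T"
    and lim: "((\<lambda>i. generator scl T (x i) - scl \<mu> (x i)) \<longlongrightarrow> 0) F"
  shows "((\<lambda>i. T t (x i) - scl (exp (of_real t * \<mu>)) (x i)) \<longlongrightarrow> 0) F"
  unfolding tendsto_iff_seminorms
proof
  fix p assume p: "p \<in> \<Gamma>"
  interpret S: lcs_semigroup scl \<Gamma> "rescaled \<mu>"
    by (rule lcs_semigroup_rescaled)
  let ?y = "\<lambda>i. generator scl T (x i) - scl \<mu> (x i)"
  obtain q C where q: "q \<in> \<Gamma>" "0 \<le> C" "\<And>s v. 0 \<le> s \<Longrightarrow> s \<le> t \<Longrightarrow> p (rescaled \<mu> s v) \<le> C * q v"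
    using p assms(1) by (rule S.equicontE) blast
  have bound: "p (T t (x i) - scl (exp (of_real t * \<mu>)) (x i)) \<le> cmod (exp (of_real t * \<mu>)) * (t * (C * q (?y i)))"
    if "i \<in> I" for i
  proof -
    have "(difference_quotient scl (rescaled \<mu>) (x i) \<longlongrightarrow> ?y i) (at_right 0)"
      using D that by (intro difference_quotient_rescaled generator_tendsto) auto
    then have "rescaled \<mu> t (x i) - x i = vec_integral t (\<lambda>s. rescaled \<mu> s (?y i))"
      using assms(1) by (intro S.orbit_increment_eq_integral)
    also have "p \<dots> \<le> integral {0..t} (\<lambda>s. C * q (?y i))"
      using assms(1) q(3) by (intro seminorm_vec_integral_le[OF p] S.continuous_on_orbit) auto
    also have "\<dots> = t * (C * q (?y i))"
      using assms(1) by simp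
    finally have "p (rescaled \<mu> t (x i) - x i) \<le> t * (C * q (?y i))" .
    moreover have "T t (x i) - scl (exp (of_real t * \<mu>)) (x i)
        = scl (exp (of_real t * \<mu>)) (rescaled \<mu> t (x i) - x i)"
      by (simp add: rescaled_def scale_right_diff_distrib flip: exp_add)
    ultimately show ?thesis
      by (simp add: seminorm_scale[OF p] mult_left_mono)
  qed
  have "((\<lambda>i. cmod (exp (of_real t * \<mu>)) * (t * (C * q (?y i))))
      \<longlongrightarrow> cmod (exp (of_real t * \<mu>)) * (t * (C * q 0))) F"
    using lim by (intro tendsto_intros tendsto_seminorm[OF q(1)])
  then have "((\<lambda>i. cmod (exp (of_real t * \<mu>)) * (t * (C * q (?y i)))) \<longlongrightarrow> 0) F"
    using seminorm_zero[OF q(1)] by simp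
  moreover have "eventually (\<lambda>i. norm (p (T t (x i) - scl (exp (of_real t * \<mu>)) (x i) - 0))
      \<le> cmod (exp (of_real t * \<mu>)) * (t * (C * q (?y i)))) F"
    using I by eventually_elim (use bound seminorm_nonneg[OF p] in simp)
  ultimately show "((\<lambda>i. p (T t (x i) - scl (exp (of_real t * \<mu>)) (x i) - 0)) \<longlongrightarrow> 0) F"
    by (rule Lim_null_comparison[rotated])
qed

text \<open>
  Let \<open>\<mu>0\<close> be one solution of \<open>exp (t * \<mu>0) = \<nu>\<close>. The other solutions \<open>\<mu>\<close> differ from it by multiples of
  \<open>2 * pi * \<i> / t\<close>, and the integrals of \<open>rescaled \<mu> s (x i)\<close> are the Fourier coefficients of the orbit
  of \<open>x i\<close> under \<open>rescaled \<mu>0\<close>. Since \<open>x\<close> does not tend to \<open>0\<close>, one of these coefficients does not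
  either, and it is a family of approximate eigenvectors of the generator for \<open>\<mu>\<close>.
\<close>
lemma approximate_eigenvectors_of_generator:
  fixes x :: "'i \<Rightarrow> 'a"
  assumes "0 < t" "\<nu> \<noteq> 0" and I: "eventually (\<lambda>i. i \<in> I) F"
    and bdd: "lcs_bounded \<Gamma> (x ` I)" and tb: "totally_bounded (x ` I)"
    and nz: "\<not> (x \<longlongrightarrow> 0) F" and lim: "((\<lambda>i. T t (x i) - scl \<nu> (x i)) \<longlongrightarrow> 0) F"
  obtains \<mu> y where "exp (of_real t * \<mu>) = \<nu>" "y ` I \<subseteq> generator_domain scl T" "lcs_bounded \<Gamma> (y ` I)"
    "\<not> (y \<longlongrightarrow> 0) F" "((\<lambda>i. generator scl T (y i) - scl \<mu> (y i)) \<longlongrightarrow> 0) F"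
proof -
  define \<mu>0 where "\<mu>0 = Ln \<nu> / of_real t"
  interpret S0: lcs_semigroup scl \<Gamma> "rescaled \<mu>0"
    by (rule lcs_semigroup_rescaled)
  obtain n :: int where n: "\<not> ((\<lambda>i. vec_integral t (\<lambda>s. scl (cis (2 * pi * n * s / t)) (rescaled \<mu>0 s (x i)))) \<longlongrightarrow> 0) F"
    using S0.tendsto_0_if_fourier_coefficients_tendsto_0[OF assms(1) bdd tb I] nz by blast
  define \<mu> where "\<mu> = \<mu>0 - of_real (2 * pi * n / t) * \<i>"
  interpret S: lcs_semigroup scl \<Gamma> "rescaled \<mu>"
    by (rule lcs_semigroup_rescaled)
  define y where "y i = vec_integral t (\<lambda>s. rescaled \<mu> s (x i))" for i
  have "scl (cis (2 * pi * n * s / t)) (rescaled \<mu>0 s v) = rescaled \<mu> s v" for s v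
    by (simp add: rescaled_def \<mu>_def cis_conv_exp algebra_simps flip: exp_add)
  with n have "\<not> (y \<longlongrightarrow> 0) F"
    by (simp add: y_def[abs_def])
  moreover have exp_\<mu>: "exp (of_real t * \<mu>) = \<nu>"
  proof -
    have "of_real t * \<mu> = Ln \<nu> + of_int (- n) * (of_real (2 * pi) * \<i>)"
      using assms(1) by (simp add: \<mu>_def \<mu>0_def field_simps)
    then show ?thesis
      using assms(2) by (simp add: exp_add exp_diff mult_ac exp_integer_2pi)
  qed
  moreover have gen: "y i \<in> generator_domain scl T"
    "generator scl T (y i) - scl \<mu> (y i) = scl (exp (- of_real t * \<mu>)) (T t (x i) - scl \<nu> (x i))" for i
  proof -
    have "(difference_quotient scl (rescaled \<mu>) (y i) \<longlongrightarrow> rescaled \<mu> t (x i) - x i) (at_right 0)"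
      unfolding y_def using assms(1) by (intro S.difference_quotient_orbit_integral) simp
    then have "(difference_quotient scl (S.rescaled (- \<mu>)) (y i)
        \<longlongrightarrow> rescaled \<mu> t (x i) - x i - scl (- \<mu>) (y i)) (at_right 0)"
      by (rule S.difference_quotient_rescaled)
    moreover have "S.rescaled (- \<mu>) = T"
      by (simp add: S.rescaled_def rescaled_def fun_eq_iff flip: exp_add)
    ultimately have "(difference_quotient scl T (y i) \<longlongrightarrow> rescaled \<mu> t (x i) - x i + scl \<mu> (y i)) (at_right 0)"
      by simp
    note eq = generator_eq[OF this]
    show "y i \<in> generator_domain scl T"
      by (rule eq)
    show "generator scl T (y i) - scl \<mu> (y i) = scl (exp (- of_real t * \<mu>)) (T t (x i) - scl \<nu> (x i))"
      unfolding eq(2) exp_\<mu>[symmetric] by (simp add: rescaled_def scale_right_diff_distrib flip: exp_add)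
  qed
  moreover have "lcs_bounded \<Gamma> (y ` I)"
    unfolding lcs_bounded_def
  proof
    fix p assume p: "p \<in> \<Gamma>"
    obtain K where K: "0 \<le> K" "\<And>s v. 0 \<le> s \<Longrightarrow> s \<le> t \<Longrightarrow> v \<in> x ` I \<Longrightarrow> p (rescaled \<mu> s v) \<le> K"
      using S.bounded_orbits[OF bdd p] assms(1) by (metis less_imp_le)
    have "p (y i) \<le> integral {0..t} (\<lambda>_. K)" if "i \<in> I" for i
      unfolding y_def using that assms(1) K(2)
      by (intro seminorm_vec_integral_le[OF p] S.continuous_on_orbit) auto
    then show "\<exists>C. \<forall>v\<in>y ` I. p v \<le> C"
      by blast
  qed
  moreover have "((\<lambda>i. scl (exp (- of_real t * \<mu>)) (T t (x i) - scl \<nu> (x i)))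
      \<longlongrightarrow> scl (exp (- of_real t * \<mu>)) 0) F"
    using lim by (intro tendsto_scale tendsto_const)
  then have "((\<lambda>i. generator scl T (y i) - scl \<mu> (y i)) \<longlongrightarrow> 0) F"
    by (simp add: gen(2))
  ultimately show ?thesis
    using that[of \<mu> y] by blast
qed

lemma bap_values_spectral_mapping:
  assumes "0 < t" and I: "eventually (\<lambda>i. i \<in> I) F"
    and tb: "\<And>S. lcs_bounded \<Gamma> S \<Longrightarrow> totally_bounded S"
  shows "bap_values F I UNIV (T t) - {0} =
    {exp (of_real t * \<mu>) |\<mu>. \<mu> \<in> bap_values F I (generator_domain scl T) (generator scl T)}"
proof (intro equalityI subsetI)
  fix \<nu> assume "\<nu> \<in> bap_values F I UNIV (T t) - {0}"
  then obtain x :: "'b \<Rightarrow> 'a" where x: "\<nu> \<noteq> 0" "lcs_bounded \<Gamma> (x ` I)" "\<not> (x \<longlongrightarrow> 0) F"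
      "((\<lambda>i. T t (x i) - scl \<nu> (x i)) \<longlongrightarrow> 0) F"
    unfolding bap_values_def by auto
  obtain \<mu> y where
    "exp (of_real t * \<mu>) = \<nu>" "y ` I \<subseteq> generator_domain scl T" "lcs_bounded \<Gamma> (y ` I)"
    "\<not> (y \<longlongrightarrow> 0) F" "((\<lambda>i. generator scl T (y i) - scl \<mu> (y i)) \<longlongrightarrow> 0) F"
    by (rule approximate_eigenvectors_of_generator[OF assms(1) x(1) I x(2) tb[OF x(2)] x(3,4)])
  then show "\<nu> \<in> {exp (of_real t * \<mu>) |\<mu>. \<mu> \<in> bap_values F I (generator_domain scl T) (generator scl T)}"
    unfolding bap_values_def by blast
next
  fix \<nu> assume "\<nu> \<in> {exp (of_real t * \<mu>) |\<mu>. \<mu> \<in> bap_values F I (generator_domain scl T) (generator scl T)}"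
  then obtain \<mu> x where "\<nu> = exp (of_real t * \<mu>)" "x ` I \<subseteq> generator_domain scl T" "lcs_bounded \<Gamma> (x ` I)"
      "\<not> (x \<longlongrightarrow> 0) F" "((\<lambda>i. generator scl T (x i) - scl \<mu> (x i)) \<longlongrightarrow> 0) F"
    unfolding bap_values_def by blast
  then show "\<nu> \<in> bap_values F I UNIV (T t) - {0}"
    using approximate_eigenvectors_of_semigroup[OF _ I, of t x \<mu>] assms(1)
    unfolding bap_values_def by auto
qed

end

theorem corollary5p11:
  fixes scl :: "complex \<Rightarrow> 'a::{topological_ab_group_add, uniform_space, t2_space} \<Rightarrow> 'a"
    and \<Gamma> :: "('a \<Rightarrow> real) set"
    and T :: "real \<Rightarrow> 'a \<Rightarrow> 'a"
  assumes "generalised_Schwartz_space scl \<Gamma>"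
    and "\<And>x :: nat \<Rightarrow> 'a. Cauchy x \<Longrightarrow> convergent x"
    and "operator_semigroup scl T"
    and "strongly_continuous T"
    and "locally_equicontinuous \<Gamma> T"
  shows "\<forall>t\<ge>0.
      ((t = 0 \<longrightarrow> sigma_bap scl \<Gamma> (generator_domain scl T) (generator scl T) \<noteq> {}) \<longrightarrow>
         sigma_bap scl \<Gamma> UNIV (T t) - {0} =
           {exp (of_real t * \<mu>) |\<mu>.
              \<mu> \<in> sigma_bap scl \<Gamma> (generator_domain scl T) (generator scl T)}) \<and>
      ((t = 0 \<longrightarrow> sigma_bap_seq scl \<Gamma> (generator_domain scl T) (generator scl T) \<noteq> {}) \<longrightarrow>
         sigma_bap_seq scl \<Gamma> UNIV (T t) - {0} =
           {exp (of_real t * \<mu>) |\<mu>.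
              \<mu> \<in> sigma_bap_seq scl \<Gamma> (generator_domain scl T) (generator scl T)})"
proof (intro allI impI)
  fix t :: real assume t: "0 \<le> t"
  interpret lcs_semigroup scl \<Gamma> T
  proof -
    interpret locally_convex_space scl \<Gamma>
      using assms(1) by (simp add: generalised_Schwartz_space_def)
    show "lcs_semigroup scl \<Gamma> T"
      by unfold_locales (use assms in auto)
  qed
  have tb: "totally_bounded S" if "lcs_bounded \<Gamma> S" for S
    using assms(1) that by (simp add: generalised_Schwartz_space_def)
  let ?D = "generator_domain scl T" and ?A = "generator scl T"
  show "((t = 0 \<longrightarrow> sigma_bap scl \<Gamma> ?D ?A \<noteq> {}) \<longrightarrow>
         sigma_bap scl \<Gamma> UNIV (T t) - {0} = {exp (of_real t * \<mu>) |\<mu>. \<mu> \<in> sigma_bap scl \<Gamma> ?D ?A}) \<and>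
      ((t = 0 \<longrightarrow> sigma_bap_seq scl \<Gamma> ?D ?A \<noteq> {}) \<longrightarrow>
         sigma_bap_seq scl \<Gamma> UNIV (T t) - {0} = {exp (of_real t * \<mu>) |\<mu>. \<mu> \<in> sigma_bap_seq scl \<Gamma> ?D ?A})"
  proof (cases "t = 0")
    case True
    have T0: "T 0 = id"
      using T_0 by auto
    have "sigma_bap scl \<Gamma> UNIV id \<subseteq> {1}"
      unfolding sigma_bap_eq_bap_values using bap_values_id by blast
    moreover have "1 \<in> sigma_bap scl \<Gamma> UNIV id" if "sigma_bap scl \<Gamma> ?D ?A \<noteq> {}"
      using that one_in_bap_values_id unfolding sigma_bap_eq_bap_values by blast
    moreover have "sigma_bap_seq scl \<Gamma> UNIV id \<subseteq> {1}"
      unfolding sigma_bap_seq_eq_bap_values by (rule bap_values_id)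
    moreover have "1 \<in> sigma_bap_seq scl \<Gamma> UNIV id" if "sigma_bap_seq scl \<Gamma> ?D ?A \<noteq> {}"
      using that one_in_bap_values_id unfolding sigma_bap_seq_eq_bap_values by blast
    ultimately show ?thesis
      unfolding True T0 by auto
  next
    case False
    then have "0 < t"
      using t by simp
    note mapping = bap_values_spectral_mapping[OF this _ tb]
    have tails: "eventually (\<lambda>i. i \<in> I) (tails I le)" if "directed_set I le" for I :: "'a set set" and le
    proof -
      have "I \<noteq> {}"
        using that by (simp add: directed_set_def)
      then show ?thesis
        unfolding eventually_tails[OF that] by blast
    qed
    have "sigma_bap scl \<Gamma> UNIV (T t) - {0}
        = {\<nu>. \<exists>(I :: 'a set set) le. directed_set I le \<and> \<nu> \<in> bap_values (tails I le) I UNIV (T t) - {0}}"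
      unfolding sigma_bap_eq_bap_values by blast
    also have "\<dots> = {\<nu>. \<exists>(I :: 'a set set) le. directed_set I le \<and>
        \<nu> \<in> {exp (of_real t * \<mu>) |\<mu>. \<mu> \<in> bap_values (tails I le) I ?D ?A}}"
      using mapping[OF tails] by (intro Collect_cong ex_cong1 conj_cong) auto
    also have "\<dots> = {exp (of_real t * \<mu>) |\<mu>. \<mu> \<in> sigma_bap scl \<Gamma> ?D ?A}"
      unfolding sigma_bap_eq_bap_values by blast
    finally show ?thesis
      using mapping[of UNIV sequentially] False unfolding sigma_bap_seq_eq_bap_values by simp
  qed
qed

end
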